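(* Let $\mu^{(n)}\in\mathbb{R}^n$ be a solution of $\mathbf{F}_n(\boldsymbol{\lambda}_n)=\mathbf{0}$. Then the equation-by-equation (EBE) method is locally convergent at $\mu^{(n)}$ under hypothesis (A) of the context. That is, there exists $\delta>0$ such that for every initial condition $\alpha=(\alpha_1,\ldots,\alpha_n)\in\mathbb{R}^n$ with $\|\alpha-\mu^{(n)}\|<\delta$ for which there are points $\mu^{(i)}\in\mathbb{R}^i$, $i=1,\ldots,n-1$, such that $\mu^{(1)},\ldots,\mu^{(n)}$ satisfy hypothesis (A), the EBE method started from $\alpha$ is well defined (all iterates in all steps $i=1,\ldots,n$ exist), its step-$i$ iteration converges to $\mu^{(i)}$ for each $i=1,\ldots,n$, and in particular its final output is the solution $\mu^{(n)}$.
   Context: Let $\Omega=[-1,1]^d$, and let $c_1,\ldots,c_n$ be an enumeration of the monomials $\mathbf{x}^{\mathbf{j}}=\prod_{k=1}^d x_k^{j_k}$ on $\Omega$ with $\mathbf{j}\in\mathbb{Z}_+^d$, $1\le|\mathbf{j}|\le p$ (so $n=\sum_{j=1}^p\binom{j+d-1}{d-1}$). Let $f_1,\ldots,f_n\in\mathbb{R}$ be given numbers (the prescribed moments). For $j=1,\ldots,n$ define $$F_j(\lambda_1,\ldots,\lambda_n)=\int_\Omega (c_j(\mathbf{x})-f_j)\exp\Big(\sum_{k=1}^n\lambda_k c_k(\mathbf{x})\Big)\,d\mathbf{x}.$$ For $1\le k\le n$ put $\mathbf{F}_k=(F_1,\ldots,F_k)$ and $\boldsymbol{\lambda}_k=(\lambda_1,\ldots,\lambda_k)$.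 Given $\alpha=(\alpha_1,\ldots,\alpha_n)\in\mathbb{R}^n$, at step $i\in\{1,\ldots,n\}$ all functions $F_1,\ldots,F_i$ are regarded as functions of $\boldsymbol{\lambda}_i=(\boldsymbol{\lambda}_{i-1},\lambda_i)\in\mathbb{R}^i$ by setting $\lambda_{k}=\alpha_{k}$ for $k>i$; these frozen arguments are suppressed from the notation. For $k\le i$, $\mathbf{F}_{k,\boldsymbol{\lambda}_{k}}$ denotes the $k\times k$ Jacobian matrix of $\mathbf{F}_{k}$ with respect to $\lambda_1,\ldots,\lambda_{k}$, and $\mathbf{F}_{i-1,\lambda_i}\in\mathbb{R}^{i-1}$ denotes the column vector of partial derivatives of $\mathbf{F}_{i-1}$ with respect to $\lambda_i$. For $i\ge2$ the map $\mathbf{H}_i=(\mathbf{H}_{i,1},H_{i,2})$, with values in $\mathbb{R}^{i-1}\times\mathbb{R}=\mathbb{R}^i$, is defined at every $(\boldsymbol{\lambda}_{i-1},\lambda_i)$ at which the inverses below exist by $$H_{i,2}(\boldsymbol{\lambda}_{i-1},\lambda_i)=\lambda_i-\Big(\frac{\partial F_i}{\partial\lambda_i}(\boldsymbol{\lambda}_{i-1},\lambda_i)\Big)^{-1}F_i(\boldsymbol{\lambda}_{i-1},\lambda_i),$$ $$\mathbf{g}_i=\boldsymbol{\lambda}_{i-1}-\mathbf{F}_{i-1,\boldsymbol{\lambda}_{i-1}}(\boldsymbol{\lambda}_{i-1},\lambda_i)^{-1}\,\mathbf{F}_{i-1,\lambda_i}(\boldsymbol{\lambda}_{i-1},\lambda_i)\,(H_{i,2}-\lambda_i),$$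 $$\mathbf{H}_{i,1}(\boldsymbol{\lambda}_{i-1},\lambda_i)=\mathbf{g}_i-\mathbf{F}_{i-1,\boldsymbol{\lambda}_{i-1}}(\mathbf{g}_i,H_{i,2})^{-1}\,\mathbf{F}_{i-1}(\mathbf{g}_i,H_{i,2}).$$ The EBE method (in exact arithmetic, each inner iteration run to its limit) started from $\alpha$: in step $1$, iterate Newton's method $\lambda_1\mapsto\lambda_1-\big(\frac{\partial F_1}{\partial\lambda_1}(\lambda_1)\big)^{-1}F_1(\lambda_1)$ starting from $\alpha_1$, and let $\mu^{(1)}\in\mathbb{R}$ be the limit. In step $i=2,\ldots,n$, iterate $\mathbf{H}_i$ starting from $(\mu^{(i-1)},\alpha_i)\in\mathbb{R}^i$, where $\mu^{(i-1)}$ is the limit obtained in step $i-1$, and let $\mu^{(i)}\in\mathbb{R}^i$ be the limit. The output is the limit obtained in step $n$. Hypothesis (A), for a given $\alpha$ and points $\mu^{(i)}\in\mathbb{R}^i$, $i=1,\ldots,n$: for every $i=1,\ldots,n$, $\mathbf{F}_i(\mu^{(i)})=\mathbf{0}$ and (1) $\frac{\partial F_i}{\partial\lambda_i}(\mu^{(i)})\neq0$; (2) the matrix $\mathbf{F}_{i,\boldsymbol{\lambda}_i}(\mu^{(i)})$ is nonsingular; (3) each component of $\mathbf{F}_i$ is twice differentiable in a closed region of $\mathbb{R}^i$ whose interior contains $\mu^{(i)}$; and for every $i=2,\ldots,n$, $\mu^{(i)}$ is a fixed point of $\mathbf{H}_i$ and $$\left|\Big(\frac{\partial F_i}{\partial\lambda_i}(\mu^{(i)})\Big)^{-1}\sum_{j=1}^{i-1}\frac{\partial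 F_j}{\partial\lambda_i}(\mu^{(i)})\,\frac{\partial F_i}{\partial\lambda_j}(\mu^{(i)})\right|<|\sigma_{i-1}|,$$ where $\sigma_{i-1}$ is an eigenvalue of smallest modulus of the $(i-1)\times(i-1)$ matrix $\mathbf{F}_{i-1,\boldsymbol{\lambda}_{i-1}}(\mu^{(i)})$. (All functions at index $i$ are evaluated with $\lambda_k=\alpha_k$ frozen for $k>i$; at $i=n$ nothing is frozen.) *)

theory Defs
  imports
    "HOL-Analysis.Analysis"
    "Jordan_Normal_Form.Gauss_Jordan_Elimination"
    "Jordan_Normal_Form.Char_Poly"
begin

unbundle no vec_syntax
hide_type (open) Finite_Cartesian_Product.vec
hide_const (open) Finite_Cartesian_Product.vec

text \<open>
  The dimension \<open>i\<close> of the unknown runs through \<open>1, ..., n\<close>, so the points of \<open>\<real>\<^sup>i\<close> are the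
  elements of \<^term>\<open>carrier_vec i :: real vec set\<close>; type-indexed vectors are used only for the
  domain \<open>[-1,1]\<^sup>d\<close>. Component indices are shifted by one: \<open>\<lambda>\<^sub>k\<close>, \<open>c\<^sub>k\<close>, \<open>f\<^sub>k\<close>, \<open>F\<^sub>k\<close> have index
  \<open>k - 1\<close> here, whereas step numbers \<open>i\<close> and dimensions are unchanged.
\<close>

subsection \<open>Euclidean space of variable dimension\<close>

definition vdist :: "nat \<Rightarrow> real vec \<Rightarrow> real vec \<Rightarrow> real" where
  "vdist i x y = L2_set (\<lambda>k. x $ k - y $ k) {..<i}"

lemma Metric_space_vdist: "Metric_space (carrier_vec i) (vdist i)"
proof
  fix x y :: "real vec"
  show "0 \<le> vdist i x y" by (simp add: vdist_def L2_set_nonneg)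
  show "vdist i x y = vdist i y x"
    by (simp add: vdist_def L2_set_def power2_commute)
  assume "x \<in> carrier_vec i" "y \<in> carrier_vec i"
  then show "vdist i x y = 0 \<longleftrightarrow> x = y"
    by (auto simp: vdist_def L2_set_eq_0_iff intro!: eq_vecI)
next
  fix x y z :: "real vec"
  have "vdist i x z = L2_set (\<lambda>k. (x $ k - y $ k) + (y $ k - z $ k)) {..<i}"
    by (simp add: vdist_def)
  also have "\<dots> \<le> vdist i x y + vdist i y z"
    unfolding vdist_def by (rule L2_set_triangle_ineq)
  finally show "vdist i x z \<le> vdist i x y + vdist i y z" .
qed

definition vtop :: "nat \<Rightarrow> real vec topology" where
  "vtop i = Metric_space.mtopology (carrier_vec i) (vdist i)"

definition closed_region :: "nat \<Rightarrow> real vec set \<Rightarrow> bool" where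
  "closed_region i S \<longleftrightarrow>
     (\<exists>U. openin (vtop i) U \<and> connectedin (vtop i) U \<and> U \<noteq> {} \<and> S = vtop i closure_of U)"

text \<open>\<open>g\<close> is a (Frechet) gradient of \<open>\<phi>\<close> at \<open>x\<close> relative to \<open>S\<close>.\<close>

definition has_gradient ::
    "nat \<Rightarrow> (real vec \<Rightarrow> real) \<Rightarrow> real vec \<Rightarrow> real vec \<Rightarrow> real vec set \<Rightarrow> bool" where
  "has_gradient i \<phi> g x S \<longleftrightarrow> g \<in> carrier_vec i \<and>
     ((\<lambda>y. (\<phi> y - \<phi> x - g \<bullet> (y - x)) / vdist i y x) \<longlongrightarrow> 0) (atin_within (vtop i) x S)"

definition twice_differentiable_on :: "nat \<Rightarrow> (real vec \<Rightarrow> real) \<Rightarrow> real vec set \<Rightarrow> bool" where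
  "twice_differentiable_on i \<phi> S \<longleftrightarrow>
     (\<exists>D. \<forall>x\<in>S. has_gradient i \<phi> (D x) x S \<and>
                 (\<forall>k<i. \<exists>h. has_gradient i (\<lambda>y. D y $ k) h x S))"

definition partial :: "(real vec \<Rightarrow> real) \<Rightarrow> nat \<Rightarrow> real vec \<Rightarrow> real" where
  "partial \<phi> s l = deriv (\<lambda>t. \<phi> (l |\<^sub>v s \<mapsto> t)) (l $ s)"

subsection \<open>The moment system\<close>

definition monomial :: "('d::finite \<Rightarrow> nat) \<Rightarrow> real ^ 'd \<Rightarrow> real" where
  "monomial j x = (\<Prod>k\<in>UNIV. vec_nth x k ^ j k)"

text \<open>\<open>e\<close> enumerates the multi-indices, so \<^term>\<open>monomial (e j)\<close> is \<open>c\<^bsub>j+1\<^esub>\<close>.\<close>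

definition moment_fun ::
    "nat \<Rightarrow> (nat \<Rightarrow> 'd::finite \<Rightarrow> nat) \<Rightarrow> (nat \<Rightarrow> real) \<Rightarrow> nat \<Rightarrow> real vec \<Rightarrow> real" where
  "moment_fun n e f j l =
     integral {x :: real ^ 'd. \<forall>k. vec_nth x k \<in> {-1..1}}
       (\<lambda>x. (monomial (e j) x - f j) * exp (\<Sum>k<n. l $ k * monomial (e k) x))"

text \<open>
  \<open>frozen \<alpha> F\<close> is the system \<open>F\<close> regarded as a system in the first \<open>i\<close> variables, for every
  \<open>i \<le> dim_vec \<alpha>\<close> at once: the entries missing from \<open>l \<in> \<real>\<^sup>i\<close> are taken from \<open>\<alpha>\<close>.
\<close>

definition frozen ::
    "real vec \<Rightarrow> (nat \<Rightarrow> real vec \<Rightarrow> real) \<Rightarrow> nat \<Rightarrow> real vec \<Rightarrow> real" where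
  "frozen \<alpha> F r l =
     F r (vec (dim_vec \<alpha>) (\<lambda>k. if k < dim_vec l then l $ k else \<alpha> $ k))"

subsection \<open>The EBE iteration for a (frozen) system \<open>G\<close>\<close>

definition sys :: "(nat \<Rightarrow> real vec \<Rightarrow> real) \<Rightarrow> nat \<Rightarrow> real vec \<Rightarrow> real vec" where
  "sys G k l = vec k (\<lambda>r. G r l)"

text \<open>\<open>k \<times> k\<close> Jacobian in the first \<open>k\<close> variables, evaluated at a point \<open>l\<close> of dimension \<open>\<ge> k\<close>.\<close>

definition jac :: "(nat \<Rightarrow> real vec \<Rightarrow> real) \<Rightarrow> nat \<Rightarrow> real vec \<Rightarrow> real mat" where
  "jac G k l = mat k k (\<lambda>(r, s). partial (G r) s l)"

text \<open>Only meaningful for invertible \<open>A\<close>; \<open>ebe_defined\<close> below guards its uses.\<close>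

definition mat_inv :: "real mat \<Rightarrow> real mat" where
  "mat_inv A = the (mat_inverse A)"

definition snoc_vec :: "real vec \<Rightarrow> real \<Rightarrow> real vec" where
  "snoc_vec v t = v @\<^sub>v vec 1 (\<lambda>_. t)"

definition H2 :: "(nat \<Rightarrow> real vec \<Rightarrow> real) \<Rightarrow> nat \<Rightarrow> real vec \<Rightarrow> real" where
  "H2 G i l = l $ (i - 1) - inverse (partial (G (i - 1)) (i - 1) l) * G (i - 1) l"

definition ebe_g :: "(nat \<Rightarrow> real vec \<Rightarrow> real) \<Rightarrow> nat \<Rightarrow> real vec \<Rightarrow> real vec" where
  "ebe_g G i l = vec_first l (i - 1) -
     (H2 G i l - l $ (i - 1)) \<cdot>\<^sub>v
       (mat_inv (jac G (i - 1) l) *\<^sub>v vec (i - 1) (\<lambda>r. partial (G r) (i - 1) l))"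

definition H1 :: "(nat \<Rightarrow> real vec \<Rightarrow> real) \<Rightarrow> nat \<Rightarrow> real vec \<Rightarrow> real vec" where
  "H1 G i l = (let y = snoc_vec (ebe_g G i l) (H2 G i l) in
     ebe_g G i l - mat_inv (jac G (i - 1) y) *\<^sub>v sys G (i - 1) y)"

definition H_map :: "(nat \<Rightarrow> real vec \<Rightarrow> real) \<Rightarrow> nat \<Rightarrow> real vec \<Rightarrow> real vec" where
  "H_map G i l = snoc_vec (H1 G i l) (H2 G i l)"

definition H_defined :: "(nat \<Rightarrow> real vec \<Rightarrow> real) \<Rightarrow> nat \<Rightarrow> real vec \<Rightarrow> bool" where
  "H_defined G i l \<longleftrightarrow> partial (G (i - 1)) (i - 1) l \<noteq> 0 \<and>
     invertible_mat (jac G (i - 1) l) \<and>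
     invertible_mat (jac G (i - 1) (snoc_vec (ebe_g G i l) (H2 G i l)))"

definition newton_map :: "(nat \<Rightarrow> real vec \<Rightarrow> real) \<Rightarrow> real vec \<Rightarrow> real vec" where
  "newton_map G l = vec 1 (\<lambda>_. l $ 0 - inverse (partial (G 0) 0 l) * G 0 l)"

definition ebe_map :: "(nat \<Rightarrow> real vec \<Rightarrow> real) \<Rightarrow> nat \<Rightarrow> real vec \<Rightarrow> real vec" where
  "ebe_map G i l = (if i = 1 then newton_map G l else H_map G i l)"

definition ebe_defined :: "(nat \<Rightarrow> real vec \<Rightarrow> real) \<Rightarrow> nat \<Rightarrow> real vec \<Rightarrow> bool" where
  "ebe_defined G i l \<longleftrightarrow> (if i = 1 then partial (G 0) 0 l \<noteq> 0 else H_defined G i l)"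

text \<open>The step-\<open>i\<close> iteration started from \<open>s\<close> never breaks down and converges to \<open>m\<close>.\<close>

definition ebe_step_converges ::
    "(nat \<Rightarrow> real vec \<Rightarrow> real) \<Rightarrow> nat \<Rightarrow> real vec \<Rightarrow> real vec \<Rightarrow> bool" where
  "ebe_step_converges G i s m \<longleftrightarrow>
     (\<exists>x. x 0 = s \<and> (\<forall>k. ebe_defined G i (x k) \<and> x (Suc k) = ebe_map G i (x k)) \<and>
          limitin (vtop i) x m sequentially)"

text \<open>
  \<open>ebe_limit F \<alpha> i m\<close>: the EBE method for \<open>F\<close> started from \<open>\<alpha>\<close> runs without breakdown through
  steps \<open>1, ..., i\<close>, each inner iteration converging, and the limit obtained in step \<open>i\<close> is \<open>m\<close>.
\<close>

inductive ebe_limit ::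
    "(nat \<Rightarrow> real vec \<Rightarrow> real) \<Rightarrow> real vec \<Rightarrow> nat \<Rightarrow> real vec \<Rightarrow> bool"
  for F :: "nat \<Rightarrow> real vec \<Rightarrow> real" and \<alpha> :: "real vec" where
  first: "ebe_step_converges (frozen \<alpha> F) 1 (vec 1 (\<lambda>_. \<alpha> $ 0)) m \<Longrightarrow> ebe_limit F \<alpha> 1 m"
| step: "ebe_limit F \<alpha> i m' \<Longrightarrow> i < dim_vec \<alpha> \<Longrightarrow>
     ebe_step_converges (frozen \<alpha> F) (Suc i) (snoc_vec m' (\<alpha> $ i)) m \<Longrightarrow>
     ebe_limit F \<alpha> (Suc i) m"

subsection \<open>The convergence hypothesis\<close>

definition smallest_eigenvalue :: "real mat \<Rightarrow> complex \<Rightarrow> bool" where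
  "smallest_eigenvalue A \<sigma> \<longleftrightarrow> eigenvalue (map_mat complex_of_real A) \<sigma> \<and>
     (\<forall>\<tau>. eigenvalue (map_mat complex_of_real A) \<tau> \<longrightarrow> cmod \<sigma> \<le> cmod \<tau>)"

definition hypothesis_A ::
    "nat \<Rightarrow> (nat \<Rightarrow> real vec \<Rightarrow> real) \<Rightarrow> real vec \<Rightarrow> (nat \<Rightarrow> real vec) \<Rightarrow> bool" where
  "hypothesis_A n F \<alpha> \<mu> \<longleftrightarrow> (let G = frozen \<alpha> F in
     (\<forall>i\<in>{1..n}.
        \<mu> i \<in> carrier_vec i \<and>
        sys G i (\<mu> i) = 0\<^sub>v i \<and>
        partial (G (i - 1)) (i - 1) (\<mu> i) \<noteq> 0 \<and>
        invertible_mat (jac G i (\<mu> i)) \<and>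
        (\<exists>S. closed_region i S \<and> \<mu> i \<in> vtop i interior_of S \<and>
             (\<forall>r<i. twice_differentiable_on i (G r) S))) \<and>
     (\<forall>i\<in>{2..n}.
        H_defined G i (\<mu> i) \<and> H_map G i (\<mu> i) = \<mu> i \<and>
        (\<exists>\<sigma>. smallest_eigenvalue (jac G (i - 1) (\<mu> i)) \<sigma> \<and>
             \<bar>inverse (partial (G (i - 1)) (i - 1) (\<mu> i)) *
               (\<Sum>j<i - 1. partial (G j) (i - 1) (\<mu> i) * partial (G (i - 1)) j (\<mu> i))\<bar>
             < cmod \<sigma>)))"

end

theory Submission
  imports Defs
begin

text \<open>
  Write \<open>\<Phi>(\<lambda>) = \<integral> exp (\<Sum>\<^sub>k \<lambda>\<^sub>k (c\<^sub>k - f\<^sub>k))\<close>. Then \<open>F\<^sub>j = exp (\<lambda> \<cdot> f) \<partial>\<^sub>j\<Phi>\<close>, and \<open>\<Phi>\<close> is strictly convex,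
  because the functions \<open>c\<^sub>k - f\<^sub>k\<close> are linearly independent on the cube. Two consequences carry the
  whole argument.

  \<^item> At a zero of the system the Jacobian is the Gram matrix of the \<open>c\<^sub>k - f\<^sub>k\<close> in a weighted \<open>L\<^sup>2\<close> space
    (\<open>moment_deriv_eq_gram\<close>), hence symmetric and positive definite. To first order, \<open>H\<^sub>i\<close> solves
    equation \<open>i\<close> for \<open>\<lambda>\<^sub>i\<close> with the other unknowns held fixed, and then the first \<open>i - 1\<close> equations for
    \<open>\<lambda>\<^sub>1, \<dots>, \<lambda>\<^sub>i\<^sub>-\<^sub>1\<close>: the predictor \<open>g\<^sub>i\<close> only moves along the tangent of their level curve and
    disappears from the linearisation. So \<open>H\<^sub>i\<close> is a perturbed block Gauss-Seidel sweep for a symmetric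
    positive definite matrix, which contracts the larger of the energy norms of the two blocks
    (\<open>gauss_seidel_contraction\<close>).
    All errors of the linearisation are controlled in a fixed neighbourhood of \<open>\<mu>\<^sup>(\<^sup>n\<^sup>)\<close>, with constants
    that do not depend on the frozen values \<open>\<alpha>\<close> (\<open>block_step_residuals\<close>,
    \<open>ebe_step_converges_locally\<close>).

  \<^item> A zero of the first \<open>i\<close> equations, with the other unknowns frozen at \<open>\<alpha>\<close>, minimises \<open>\<Phi>\<close> over an
    affine slice. Quantitative convexity (\<open>moment_monotone\<close>) forces it to be close to
    \<open>\<mu>\<^sup>(\<^sup>n\<^sup>)\<close> whenever \<open>\<alpha>\<close> is (\<open>frozen_zero_near\<close>).

  Consequently the starting point \<open>(\<mu>\<^sup>(\<^sup>i\<^sup>-\<^sup>1\<^sup>), \<alpha>\<^sub>i)\<close> of step \<open>i\<close> and its target \<open>\<mu>\<^sup>(\<^sup>i\<^sup>)\<close> both lie in the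
  neighbourhood in which \<open>H\<^sub>i\<close> contracts towards \<open>\<mu>\<^sup>(\<^sup>i\<^sup>)\<close>, and the theorem follows by induction on \<open>i\<close>.
  Newton's method in step 1 is the case \<open>i = 1\<close> of \<open>H\<^sub>i\<close>, with an empty first block.
\<close>

section \<open>Coercive quadratic forms\<close>

definition l1 :: "nat \<Rightarrow> (nat \<Rightarrow> real) \<Rightarrow> real" where
  "l1 k v = (\<Sum>j<k. \<bar>v j\<bar>)"

definition qform :: "(nat \<Rightarrow> nat \<Rightarrow> real) \<Rightarrow> nat \<Rightarrow> (nat \<Rightarrow> real) \<Rightarrow> real" where
  "qform S k v = (\<Sum>j<k. \<Sum>l<k. S j l * v j * v l)"

text \<open>
  Coercivity is measured in the \<open>l\<^sup>1\<close> norm because it is dual to the maximum norm, in which the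
  residuals of a linear system are bounded componentwise; no factor depending on the dimension
  then appears in the estimates.
\<close>

definition coercive :: "real \<Rightarrow> nat \<Rightarrow> (nat \<Rightarrow> nat \<Rightarrow> real) \<Rightarrow> bool" where
  "coercive \<kappa> k S \<longleftrightarrow> \<kappa> > 0 \<and> (\<forall>v. \<kappa> * (l1 k v)\<^sup>2 \<le> qform S k v)"

lemma l1_nonneg [simp]: "0 \<le> l1 k v"
  by (simp add: l1_def sum_nonneg)

lemma l1_cong: "(\<And>j. j < k \<Longrightarrow> v j = w j) \<Longrightarrow> l1 k v = l1 k w"
  by (simp add: l1_def)

lemma l1_component: "j < k \<Longrightarrow> \<bar>v j\<bar> \<le> l1 k v"
  unfolding l1_def by (rule member_le_sum) auto

lemma l1_Suc: "l1 (Suc k) v = l1 k v + \<bar>v k\<bar>"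
  by (simp add: l1_def)

lemma l1_triangle: "l1 k (\<lambda>j. x j - z j) \<le> l1 k (\<lambda>j. x j - y j) + l1 k (\<lambda>j. y j - z j)"
  unfolding l1_def sum.distrib [symmetric] by (intro sum_mono) linarith

lemma l1_commute: "l1 k (\<lambda>j. x j - y j) = l1 k (\<lambda>j. y j - x j)"
  by (simp add: l1_def abs_minus_commute)

lemma l1_mult: "l1 k (\<lambda>j. c * v j) = \<bar>c\<bar> * l1 k v"
  by (simp add: l1_def abs_mult sum_distrib_left)

lemma l1_mono: "(\<And>j. j < k \<Longrightarrow> \<bar>v j\<bar> \<le> \<bar>w j\<bar>) \<Longrightarrow> l1 k v \<le> l1 k w"
  unfolding l1_def by (rule sum_mono) auto

lemma l1_zero_extend:
  assumes "k \<le> n" "\<And>j. j < k \<Longrightarrow> w j = v j" "\<And>j. k \<le> j \<Longrightarrow> j < n \<Longrightarrow> w j = 0"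
  shows "l1 n w = l1 k v"
proof -
  have "l1 n w = (\<Sum>j<k. \<bar>w j\<bar>)"
    unfolding l1_def using assms by (intro sum.mono_neutral_right) auto
  then show ?thesis using assms by (simp add: l1_def)
qed

lemma pairing_le:
  fixes a v :: "nat \<Rightarrow> real"
  assumes "\<And>j. j < k \<Longrightarrow> \<bar>a j\<bar> \<le> R"
  shows "\<bar>\<Sum>j<k. a j * v j\<bar> \<le> R * l1 k v"
proof -
  have "\<bar>\<Sum>j<k. a j * v j\<bar> \<le> (\<Sum>j<k. \<bar>a j * v j\<bar>)" by (rule sum_abs)
  also have "\<dots> \<le> (\<Sum>j<k. R * \<bar>v j\<bar>)"
    using assms by (intro sum_mono) (auto simp: abs_mult intro!: mult_right_mono)
  finally show ?thesis by (simp add: l1_def sum_distrib_left)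
qed

lemma qform_alt: "qform S k v = (\<Sum>j<k. v j * (\<Sum>l<k. S j l * v l))"
  by (simp add: qform_def sum_distrib_left mult_ac)

lemma qform_le:
  assumes "\<And>j l. j < k \<Longrightarrow> l < k \<Longrightarrow> \<bar>S j l\<bar> \<le> R"
  shows "\<bar>qform S k v\<bar> \<le> R * (l1 k v)\<^sup>2"
proof -
  have "\<bar>\<Sum>j<k. (\<Sum>l<k. S j l * v l) * v j\<bar> \<le> (R * l1 k v) * l1 k v"
    by (intro pairing_le) (use assms in auto)
  then show ?thesis by (simp add: qform_alt power2_eq_square mult_ac)
qed

lemma qform_scale: "qform S k (\<lambda>j. c * v j) = c\<^sup>2 * qform S k v"
  by (simp add: qform_def sum_distrib_left power2_eq_square mult_ac)

lemma qform_zero_extend: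
  assumes "k \<le> n" "\<And>j. j < k \<Longrightarrow> w j = v j" "\<And>j. k \<le> j \<Longrightarrow> j < n \<Longrightarrow> w j = 0"
  shows "qform S n w = qform S k v"
proof -
  have *: "(\<Sum>l<n. S j l * w j * w l) = (\<Sum>l<k. S j l * w j * w l)" for j
    using assms by (intro sum.mono_neutral_right) auto
  have "qform S n w = (\<Sum>j<k. \<Sum>l<k. S j l * w j * w l)"
    unfolding qform_def * using assms by (intro sum.mono_neutral_right) auto
  then show ?thesis using assms by (simp add: qform_def)
qed

lemma coercive_mono:
  assumes "coercive \<kappa> n S" "k \<le> n"
  shows "coercive \<kappa> k S"
proof -
  have "\<kappa> * (l1 k v)\<^sup>2 \<le> qform S k v" for v
  proof -
    define w where "w = (\<lambda>j. if j < k then v j else 0)"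
    have "l1 n w = l1 k v" "qform S n w = qform S k v"
      using assms(2) by (auto simp: w_def intro!: l1_zero_extend qform_zero_extend)
    then show ?thesis using assms(1) unfolding coercive_def by metis
  qed
  then show ?thesis using assms(1) by (auto simp: coercive_def)
qed

lemma coercive_diag:
  assumes "coercive \<kappa> n S" "k < n"
  shows "\<kappa> \<le> S k k"
proof -
  define v where "v = (\<lambda>j. if j = k then 1 else (0::real))"
  have *: "(\<Sum>j<n. c j * v j) = c k" for c :: "nat \<Rightarrow> real"
    using assms(2) by (simp add: v_def if_distrib [of "(*) _"] cong: if_cong)
  have "qform S n v = S k k"
    unfolding qform_alt * using * [of "\<lambda>j. S j k"] by (simp add: mult.commute)
  moreover have "l1 n v = 1"
    using assms(2) by (simp add: l1_def v_def if_distrib [of abs] cong: if_cong)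
  ultimately show ?thesis using assms(1) by (auto simp: coercive_def dest: spec [of _ v])
qed

text \<open>
  By homogeneity it is enough to bound the form below on the unit sphere of \<open>l\<^sup>1\<close>. The dimension is a
  variable, so this sphere is realised inside the space of all functions on \<^typ>\<open>nat\<close>, where it is
  compact by Tychonoff's theorem.
\<close>

lemma pos_def_imp_coercive:
  assumes pos: "\<And>v j. j < n \<Longrightarrow> v j \<noteq> 0 \<Longrightarrow> 0 < qform S n v"
  shows "\<exists>\<kappa>. coercive \<kappa> n S"
proof -
  define B :: "(nat \<Rightarrow> real) set" where
    "B = (\<Pi>\<^sub>E j\<in>UNIV. if j < n then {-1..1} else {0})"
  define K where "K = {v. l1 n v = 1} \<inter> B"
  have "compactin (product_topology (\<lambda>_. euclidean) UNIV) B"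
    unfolding B_def compactin_PiE by auto
  then have "compact B"
    by (simp add: euclidean_product_topology)
  moreover have cl: "continuous_on UNIV (l1 n)"
    unfolding l1_def by (intro continuous_intros continuous_on_product_coordinates)
  have "closed {v. l1 n v = 1}"
    using continuous_closed_preimage_constant [OF cl closed_UNIV, of 1] by simp
  ultimately have cK: "compact K"
    unfolding K_def by (rule closed_Int_compact [rotated])
  have q: "continuous_on K (qform S n)"
    unfolding qform_def
    by (intro continuous_intros continuous_on_subset [OF continuous_on_product_coordinates]) auto
  have scale: "\<exists>u\<in>K. qform S n v = (l1 n v)\<^sup>2 * qform S n u" if "l1 n v \<noteq> 0" for v
  proof -
    define u where "u = (\<lambda>j. if j < n then v j / l1 n v else 0)"
    have "l1 n u = 1"
      using that l1_mult [of n "1 / l1 n v" v] l1_cong [of n u "\<lambda>j. 1 / l1 n v * v j"]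
      by (simp add: u_def)
    moreover have "u \<in> B"
    proof -
      have "0 < l1 n v" using that l1_nonneg [of n v] by linarith
      then have "\<bar>v j / l1 n v\<bar> \<le> 1" if "j < n" for j
        using l1_component [OF that, of v] by (simp add: abs_divide)
      then have "- 1 \<le> v j / l1 n v \<and> v j / l1 n v \<le> 1" if "j < n" for j
        using that by (metis abs_le_iff minus_le_iff)
      then show ?thesis
        unfolding B_def u_def by (auto simp: PiE_iff)
    qed
    ultimately have "u \<in> K" by (simp add: K_def)
    moreover have "qform S n v = qform S n (\<lambda>j. l1 n v * u j)"
      using that by (simp add: qform_def u_def)
    ultimately show ?thesis using qform_scale [of S n "l1 n v" u] by auto
  qed
  show ?thesis
  proof (cases "K = {}")
    case True
    then have "l1 n v = 0" for v using scale by blast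
    moreover from this have "qform S n v = 0" for v
      using l1_component [of _ n v] by (simp add: qform_def)
    ultimately show ?thesis by (auto simp: coercive_def intro: exI [of _ 1])
  next
    case False
    then obtain u where u: "u \<in> K" "\<And>v. v \<in> K \<Longrightarrow> qform S n u \<le> qform S n v"
      using continuous_attains_inf [OF cK _ q] by blast
    have "\<exists>j<n. u j \<noteq> 0"
      using u(1) by (force simp: K_def l1_def intro: ccontr)
    then have "0 < qform S n u" using pos by blast
    moreover have "qform S n u * (l1 n v)\<^sup>2 \<le> qform S n v" for v
    proof (cases "l1 n v = 0")
      case True
      then have "qform S n v = 0"
        using l1_component [of _ n v] by (simp add: qform_def)
      then show ?thesis using True by simp
    next
      case False
      from scale [OF this] u(2) show ?thesis
        by (metis mult.commute mult_left_mono zero_le_power2)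
    qed
    ultimately show ?thesis by (auto simp: coercive_def)
  qed
qed

text \<open>
  Pairing \<open>B v\<close> with \<open>v\<close> gives at least half of \<open>\<kappa> \<parallel>v\<parallel>\<^sup>2\<close>, as the perturbation eats at most the other
  half. This replaces a bound on the inverse matrix.
\<close>

lemma perturbed_solution_bound:
  assumes S: "coercive \<kappa> k S"
    and B: "\<And>j l. j < k \<Longrightarrow> l < k \<Longrightarrow> \<bar>B j l - S j l\<bar> \<le> \<kappa> / 2"
    and R: "\<And>j. j < k \<Longrightarrow> \<bar>\<Sum>l<k. B j l * v l\<bar> \<le> R" "0 \<le> R"
  shows "l1 k v \<le> 2 * R / \<kappa>"
proof -
  have \<kappa>: "\<kappa> > 0" using S by (simp add: coercive_def)
  have "\<bar>qform B k v\<bar> \<le> R * l1 k v"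
    unfolding qform_alt using pairing_le [of k "\<lambda>j. \<Sum>l<k. B j l * v l" R v] R
    by (simp add: mult.commute)
  moreover have "\<bar>qform (\<lambda>j l. B j l - S j l) k v\<bar> \<le> \<kappa> / 2 * (l1 k v)\<^sup>2"
    by (rule qform_le) (use B in auto)
  moreover have "qform (\<lambda>j l. B j l - S j l) k v = qform B k v - qform S k v"
    by (simp add: qform_def sum_subtractf left_diff_distrib)
  moreover have "\<kappa> * (l1 k v)\<^sup>2 \<le> qform S k v"
    using S by (simp add: coercive_def)
  ultimately have "\<kappa> / 2 * (l1 k v)\<^sup>2 \<le> R * l1 k v" by linarith
  then have "l1 k v = 0 \<or> \<kappa> / 2 * l1 k v \<le> R"
    using mult_le_cancel_right_pos [of "l1 k v" "\<kappa> / 2 * l1 k v" R] l1_nonneg [of k v]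
    unfolding power2_eq_square mult.assoc by linarith
  then show ?thesis using \<kappa> R(2) by (auto simp: field_simps)
qed

lemma perturbed_invertible:
  assumes S: "coercive \<kappa> k S"
    and B: "\<And>j l. j < k \<Longrightarrow> l < k \<Longrightarrow> \<bar>B j l - S j l\<bar> \<le> \<kappa> / 2"
  defines "M \<equiv> Matrix.mat k k (\<lambda>(j, l). B j l)"
  shows "invertible_mat M"
    and "mat_inv M \<in> carrier_mat k k"
    and "r \<in> carrier_vec k \<Longrightarrow> M *\<^sub>v (mat_inv M *\<^sub>v r) = r"
proof -
  have M: "M \<in> carrier_mat k k" by (simp add: M_def)
  have "x = 0\<^sub>v k" if x: "x \<in> carrier_vec k" "M *\<^sub>v x = 0\<^sub>v k" for x
  proof -
    have "(\<Sum>l<k. B j l * x $ l) = 0" if "j < k" for j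
    proof -
      have "(M *\<^sub>v x) $ j = (\<Sum>l<k. B j l * x $ l)"
        using x(1) that by (auto simp: M_def scalar_prod_def lessThan_atLeast0 intro!: sum.cong)
      then show ?thesis using x that by simp
    qed
    then have "l1 k (\<lambda>l. x $ l) \<le> 0"
      using perturbed_solution_bound [OF S B, of "\<lambda>l. x $ l" 0] by simp
    then show ?thesis
      using x(1) l1_component [of _ k "\<lambda>l. x $ l"] by (intro eq_vecI) fastforce+
  qed
  then have "det M \<noteq> 0" using det_0_iff_vec_prod_zero [OF M] by blast
  then have "M \<in> Units (ring_mat TYPE(real) k ())"
    by (rule det_non_zero_imp_unit [OF M])
  then obtain N where N: "mat_inverse M = Some N"
    using mat_inverse(1) [OF M, where b = "()"] by (cases "mat_inverse M") blast+
  note MN = mat_inverse(2) [OF M N]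
  have eq: "mat_inv M = N" by (simp add: mat_inv_def N)
  show "invertible_mat M"
    unfolding invertible_mat_def inverts_mat_def using M MN by (auto intro!: exI [of _ N])
  show "mat_inv M \<in> carrier_mat k k" using MN eq by simp
  show "M *\<^sub>v (mat_inv M *\<^sub>v r) = r" if "r \<in> carrier_vec k"
    using that M MN eq by (metis assoc_mult_mat_vec one_mult_mat_vec)
qed

section \<open>Contraction of perturbed block Gauss-Seidel sweeps\<close>

text \<open>
  The off-diagonal block of a positive definite matrix satisfies the Cauchy-Schwarz inequality in
  the energy norms of the two diagonal blocks with a constant below 1. Indeed the form is at
  least \<open>\<kappa>/R\<close> times its block diagonal part, and testing this at \<open>(u, t)\<close> for the \<open>t\<close> of the least
  favourable sign and of the same energy as \<open>u\<close> bounds the off-diagonal term.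
\<close>

lemma strict_Cauchy_Schwarz:
  assumes S: "coercive \<kappa> (Suc k) S" and sym: "\<And>j. j < k \<Longrightarrow> S j k = S k j"
    and bd: "\<And>j l. j < Suc k \<Longrightarrow> l < Suc k \<Longrightarrow> \<bar>S j l\<bar> \<le> R" and "0 < R"
  shows "\<bar>\<Sum>j<k. S k j * u j\<bar> \<le> (1 - \<kappa> / R) * sqrt (S k k) * sqrt (qform S k u)"
proof -
  define b where "b = (\<Sum>j<k. S k j * u j)"
  define d where "d = S k k"
  define a where "a = sqrt (qform S k u)"
  have \<kappa>: "0 < \<kappa>" and Sk: "\<And>v. \<kappa> * (l1 k v)\<^sup>2 \<le> qform S k v"
    using S coercive_mono [OF S, of k] by (auto simp: coercive_def)
  have d: "\<kappa> \<le> d" unfolding d_def by (rule coercive_diag [OF S]) simp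
  have q0: "0 \<le> qform S k u" using Sk [of u] \<kappa> by (meson order_trans mult_nonneg_nonneg less_imp_le zero_le_power2)
  then have a2: "a\<^sup>2 = qform S k u" and a0: "0 \<le> a" by (simp_all add: a_def)
  have sd: "(sqrt d)\<^sup>2 = d" "sqrt d > 0" using d \<kappa> by auto
  have key: "\<kappa> / R * (a\<^sup>2 + d * t\<^sup>2) \<le> a\<^sup>2 + 2 * t * b + d * t\<^sup>2" for t
  proof -
    define v where "v = (\<lambda>j. if j = k then t else u j)"
    have vk: "v k = t" and vj: "v j = u j" if "j < k" for j
      using that by (auto simp: v_def)
    have l: "l1 (Suc k) v = l1 k u + \<bar>t\<bar>"
      by (simp add: l1_Suc v_def) (rule l1_cong, simp)
    have in1: "(\<Sum>j<k. \<Sum>l<k. S j l * v j * v l) = qform S k u"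
      unfolding qform_def by (intro sum.cong refl) (auto simp: v_def)
    have in2: "(\<Sum>l<k. S k l * v k * v l) = t * b"
      unfolding b_def sum_distrib_left by (intro sum.cong refl) (auto simp: v_def)
    have in3: "(\<Sum>j<k. S j k * v j * v k) = t * b"
      unfolding b_def sum_distrib_left by (intro sum.cong refl) (auto simp: v_def sym)
    have "qform S (Suc k) v = a\<^sup>2 + 2 * t * b + d * t\<^sup>2"
      unfolding qform_def using in1 in2 in3
      by (simp add: sum.distrib a2 d_def v_def power2_eq_square [of t])
    moreover have "\<kappa> * (l1 k u + \<bar>t\<bar>)\<^sup>2 \<le> qform S (Suc k) v"
      using S l by (metis coercive_def)
    moreover have "a\<^sup>2 + d * t\<^sup>2 \<le> R * (l1 k u + \<bar>t\<bar>)\<^sup>2"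
    proof -
      have "a\<^sup>2 \<le> R * (l1 k u)\<^sup>2"
        using qform_le [of k S R u] bd a2 by simp
      moreover have "d * t\<^sup>2 \<le> R * \<bar>t\<bar>\<^sup>2"
        using bd [of k k] by (auto simp: d_def intro!: mult_right_mono)
      moreover have "(l1 k u)\<^sup>2 + \<bar>t\<bar>\<^sup>2 \<le> (l1 k u + \<bar>t\<bar>)\<^sup>2"
        by (simp add: power2_sum)
      then have "R * (l1 k u)\<^sup>2 + R * \<bar>t\<bar>\<^sup>2 \<le> R * (l1 k u + \<bar>t\<bar>)\<^sup>2"
        using \<open>0 < R\<close> by (metis distrib_left less_imp_le mult_left_mono)
      ultimately show ?thesis by linarith
    qed
    then have "\<kappa> / R * (a\<^sup>2 + d * t\<^sup>2) \<le> \<kappa> / R * (R * (l1 k u + \<bar>t\<bar>)\<^sup>2)"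
      using \<kappa> \<open>0 < R\<close> by (intro mult_left_mono) auto
    ultimately show ?thesis using \<open>0 < R\<close> by simp
  qed
  have "\<bar>b\<bar> \<le> (1 - \<kappa> / R) * sqrt d * a"
  proof (cases "a = 0")
    case True
    then have "\<kappa> * (l1 k u)\<^sup>2 \<le> 0" using Sk [of u] a2 by simp
    then have "l1 k u = 0" using \<kappa> by (simp add: mult_le_0_iff)
    then have "b = 0" using l1_component [of _ k u] by (simp add: b_def)
    then show ?thesis using True by simp
  next
    case False
    then have a: "a > 0" using a0 by simp
    \<comment> \<open>the last component has the energy \<open>d t\<^sup>2 = a\<^sup>2\<close> of \<open>u\<close>, and the cross term is negative\<close>
    define t where "t = - sgn b * (a / sqrt d)"
    have dt: "d * t\<^sup>2 = (sgn b)\<^sup>2 * a\<^sup>2"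
      unfolding t_def power_mult_distrib power_divide using sd d \<kappa> by simp
    have tb: "t * b = - (\<bar>b\<bar> * a / sqrt d)"
      by (simp add: t_def abs_sgn mult_ac)
    show ?thesis
    proof (cases "b = 0")
      case True
      have "\<kappa> / R \<le> 1"
      proof -
        have "\<kappa> \<le> R" using d bd [of k k] by (simp add: d_def)
        then show ?thesis using \<open>0 < R\<close> by simp
      qed
      then show ?thesis using True a sd by simp
    next
      case False
      then have "d * t\<^sup>2 = a\<^sup>2" using dt by (simp add: sgn_if)
      with key [of t] tb have "\<kappa> / R * (2 * a\<^sup>2) \<le> 2 * a\<^sup>2 - 2 * (\<bar>b\<bar> * a / sqrt d)"
        by (simp add: mult.assoc)
      moreover have "((1 - \<kappa> / R) * a) * a = a\<^sup>2 - \<kappa> / R * a\<^sup>2"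
        by (simp add: power2_eq_square left_diff_distrib)
      moreover have "\<kappa> / R * (2 * a\<^sup>2) = 2 * (\<kappa> / R * a\<^sup>2)" by simp
      ultimately have "\<bar>b\<bar> * a / sqrt d \<le> ((1 - \<kappa> / R) * a) * a" by linarith
      then have "\<bar>b\<bar> / sqrt d * a \<le> ((1 - \<kappa> / R) * a) * a" by simp
      then have "\<bar>b\<bar> / sqrt d \<le> (1 - \<kappa> / R) * a"
        using a by (rule mult_right_le_imp_le)
      then show ?thesis using sd by (simp add: pos_divide_le_eq mult_ac)
    qed
  qed
  then show ?thesis by (simp add: a_def b_def d_def)
qed

text \<open>
  Let \<open>N\<close> be the larger of the energy norms of the two blocks. An exact sweep replaces the energy of
  the last unknown by at most \<open>\<theta>\<close> times the energy of the first block, and then the energy of the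
  first block by at most \<open>\<theta>\<close> times the new energy of the last unknown, where \<open>\<theta> = 1 - \<kappa>/R\<close> is the
  constant of \<open>strict_Cauchy_Schwarz\<close>. So \<open>N\<close> contracts with room to spare, and residuals that are
  small relative to the old error can be absorbed.
\<close>

lemma gauss_seidel_contraction:
  assumes S: "coercive \<kappa> (Suc k) S" and sym: "\<And>j. j < k \<Longrightarrow> S j k = S k j"
  obtains N :: "(nat \<Rightarrow> real) \<Rightarrow> real" and q \<eta> a b where
    "0 \<le> q" "q < 1" "0 < \<eta>" "0 < a" "0 < b"
    "\<And>v. l1 (Suc k) v \<le> a * N v" "\<And>v. N v \<le> b * l1 (Suc k) v"
    "\<And>v w. \<bar>S k k * w k + (\<Sum>j<k. S k j * v j)\<bar> \<le> \<eta> * l1 (Suc k) v \<Longrightarrow>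
        (\<And>j. j < k \<Longrightarrow> \<bar>(\<Sum>l<k. S j l * w l) + S j k * w k\<bar> \<le> \<eta> * l1 (Suc k) v) \<Longrightarrow>
        N w \<le> q * N v"
proof -
  define R where "R = \<kappa> + (\<Sum>j<Suc k. \<Sum>l<Suc k. \<bar>S j l\<bar>)"
  define d where "d = S k k"
  define E where "E v = sqrt (qform S k v)" for v
  define N where "N v = max (E v) (sqrt d * \<bar>v k\<bar>)" for v :: "nat \<Rightarrow> real"
  define \<theta> where "\<theta> = 1 - \<kappa> / R"
  \<comment> \<open>Residuals of this size raise the factor of each half-sweep by at most \<open>\<kappa>/(4 R)\<close>, and \<open>\<theta> + 2 \<cdot> \<kappa>/(4 R) = 1 - \<kappa>/(2 R)\<close>.\<close>
  define \<eta> where "\<eta> = (\<kappa> / R) * \<kappa> / 8"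
  have \<kappa>: "0 < \<kappa>" and Sk: "\<And>v. \<kappa> * (l1 k v)\<^sup>2 \<le> qform S k v"
    using S coercive_mono [OF S, of k] by (auto simp: coercive_def)
  have d: "\<kappa> \<le> d" unfolding d_def by (rule coercive_diag [OF S]) simp
  then have sd: "(sqrt d)\<^sup>2 = d" "sqrt d > 0" "sqrt \<kappa> \<le> sqrt d" using \<kappa> by auto
  have bd: "\<bar>S j l\<bar> \<le> R" if "j < Suc k" "l < Suc k" for j l
  proof -
    have "\<bar>S j l\<bar> \<le> (\<Sum>l<Suc k. \<bar>S j l\<bar>)"
      by (rule member_le_sum) (use that in auto)
    also have "\<dots> \<le> (\<Sum>j<Suc k. \<Sum>l<Suc k. \<bar>S j l\<bar>)"
      by (rule member_le_sum [of j _ "\<lambda>j. \<Sum>l<Suc k. \<bar>S j l\<bar>"])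
        (use that in \<open>auto intro!: sum_nonneg add_nonneg_nonneg\<close>)
    finally show ?thesis using \<kappa> by (simp add: R_def)
  qed
  have R: "0 < R" "\<kappa> \<le> R"
    using \<kappa> d bd [of k k] by (auto simp: d_def)
  have \<theta>: "0 \<le> \<theta>" "\<theta> < 1" using \<kappa> R by (auto simp: \<theta>_def)
  have \<eta>: "0 < \<eta>" using \<kappa> R by (simp add: \<eta>_def)
  have CS: "\<bar>\<Sum>j<k. S k j * u j\<bar> \<le> \<theta> * sqrt d * E u" for u
    unfolding \<theta>_def d_def E_def by (rule strict_Cauchy_Schwarz [OF S sym bd R(1)])
  have q0: "0 \<le> qform S k u" for u
    using Sk [of u] \<kappa> by (meson order_trans mult_nonneg_nonneg less_imp_le zero_le_power2)
  then have E0: "0 \<le> E u" and E2: "(E u)\<^sup>2 = qform S k u" for u by (auto simp: E_def)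
  have El: "sqrt \<kappa> * l1 k u \<le> E u" for u
    unfolding E_def using real_sqrt_le_mono [OF Sk [of u]] by (simp add: real_sqrt_mult)
  have EN: "E v \<le> N v" "sqrt d * \<bar>v k\<bar> \<le> N v" for v by (auto simp: N_def)
  have lN: "sqrt \<kappa> * l1 (Suc k) v \<le> 2 * N v" for v
  proof -
    have "sqrt \<kappa> * \<bar>v k\<bar> \<le> sqrt d * \<bar>v k\<bar>" using sd by (intro mult_right_mono) auto
    then show ?thesis using El [of v] EN [of v] by (simp add: l1_Suc distrib_left)
  qed
  have sk: "0 < sqrt \<kappa>" "(sqrt \<kappa>)\<^sup>2 = \<kappa>" using \<kappa> by auto
  have Nl: "N v \<le> sqrt R * l1 (Suc k) v" for v
  proof -
    have "qform S k v \<le> R * (l1 k v)\<^sup>2" using qform_le [of k S R v] bd by simp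
    then have "E v \<le> sqrt R * l1 k v"
      unfolding E_def using real_sqrt_le_mono by (fastforce simp: real_sqrt_mult)
    also have "\<dots> \<le> sqrt R * l1 (Suc k) v" using R by (intro mult_left_mono) (auto simp: l1_Suc)
    finally have "E v \<le> sqrt R * l1 (Suc k) v" .
    moreover have "sqrt d * \<bar>v k\<bar> \<le> sqrt R * l1 (Suc k) v"
      using bd [of k k] R by (intro mult_mono l1_component) (auto simp: d_def)
    ultimately show ?thesis by (simp add: N_def)
  qed
  have step: "N w \<le> (1 - \<kappa> / R / 2) * N v"
    if r1: "\<bar>S k k * w k + (\<Sum>j<k. S k j * v j)\<bar> \<le> \<eta> * l1 (Suc k) v"
      and r2: "\<And>j. j < k \<Longrightarrow> \<bar>(\<Sum>l<k. S j l * w l) + S j k * w k\<bar> \<le> \<eta> * l1 (Suc k) v"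
    for v w
  proof -
    define V where "V = \<eta> * l1 (Suc k) v"
    have V0: "0 \<le> V" using \<eta> by (simp add: V_def)
    have V: "V / sqrt \<kappa> \<le> 2 * \<eta> / \<kappa> * N v"
    proof -
      have "V * sqrt \<kappa> \<le> 2 * \<eta> * N v"
        using mult_left_mono [OF lN [of v], of \<eta>] \<eta> by (simp add: V_def mult_ac)
      then have "V * sqrt \<kappa> / (sqrt \<kappa>)\<^sup>2 \<le> 2 * \<eta> * N v / (sqrt \<kappa>)\<^sup>2"
        by (rule divide_right_mono) simp
      moreover have "V / sqrt \<kappa> = V * sqrt \<kappa> / (sqrt \<kappa>)\<^sup>2"
        using sk(1) unfolding power2_eq_square by (simp del: real_sqrt_mult_self)
      ultimately show ?thesis by (simp only: sk times_divide_eq_left)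
    qed
    have e: "2 * \<eta> / \<kappa> = \<kappa> / R / 4" using \<kappa> by (simp add: \<eta>_def)
    have t: "sqrt d * \<bar>w k\<bar> \<le> \<theta> * E v + V / sqrt \<kappa>"
    proof -
      have "d * \<bar>w k\<bar> \<le> \<theta> * sqrt d * E v + V"
      proof -
        have "d * \<bar>w k\<bar> = \<bar>d * w k\<bar>" using d \<kappa> by (simp add: abs_mult)
        also have "\<dots> \<le> \<bar>\<Sum>j<k. S k j * v j\<bar> + V"
          using r1 unfolding V_def d_def by linarith
        finally show ?thesis using CS [of v] by linarith
      qed
      moreover have "sqrt d * (sqrt d * \<bar>w k\<bar>) = d * \<bar>w k\<bar>"
        by (metis mult.assoc power2_eq_square sd(1))
      moreover have "sqrt d * (\<theta> * E v + V / sqrt d) = \<theta> * sqrt d * E v + V"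
        using sd(2) by (simp add: distrib_left)
      ultimately have "sqrt d * (sqrt d * \<bar>w k\<bar>) \<le> sqrt d * (\<theta> * E v + V / sqrt d)"
        by linarith
      then have "sqrt d * \<bar>w k\<bar> \<le> \<theta> * E v + V / sqrt d" using sd by simp
      also have "V / sqrt d \<le> V / sqrt \<kappa>" using V0 sk sd by (intro divide_left_mono) auto
      finally show ?thesis by simp
    qed
    have u: "E w \<le> \<theta> * (sqrt d * \<bar>w k\<bar>) + V / sqrt \<kappa>"
    proof (cases "E w = 0")
      case True
      then show ?thesis using \<theta> sd V0 sk by simp
    next
      case False
      then have Ew: "0 < E w" using E0 [of w] by simp
      define r where "r j = (\<Sum>l<k. S j l * w l) + S j k * w k" for j
      have "(E w)\<^sup>2 = (\<Sum>j<k. w j * (r j - S j k * w k))"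
        unfolding E2 qform_alt r_def by simp
      also have "\<dots> = (\<Sum>j<k. r j * w j) - w k * (\<Sum>j<k. S k j * w j)"
        unfolding sum_distrib_left sum_subtractf [symmetric]
        by (intro sum.cong refl) (simp add: sym algebra_simps)
      also have "\<dots> \<le> V * l1 k w + \<bar>w k\<bar> * (\<theta> * sqrt d * E w)"
      proof -
        have "\<bar>\<Sum>j<k. r j * w j\<bar> \<le> V * l1 k w"
          by (rule pairing_le) (use r2 in \<open>simp add: r_def V_def\<close>)
        moreover have "\<bar>w k * (\<Sum>j<k. S k j * w j)\<bar> \<le> \<bar>w k\<bar> * (\<theta> * sqrt d * E w)"
          unfolding abs_mult by (intro mult_left_mono CS) simp
        ultimately show ?thesis by linarith
      qed
      also have "V * l1 k w \<le> V * (E w / sqrt \<kappa>)"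
        using El [of w] sk V0 by (intro mult_left_mono) (auto simp: field_simps)
      finally have "E w * E w \<le> (\<theta> * (sqrt d * \<bar>w k\<bar>) + V / sqrt \<kappa>) * E w"
        by (simp add: power2_eq_square algebra_simps)
      then show ?thesis using Ew by simp
    qed
    have N0: "0 \<le> N v" using E0 [of v] EN [of v] by linarith
    have "sqrt d * \<bar>w k\<bar> \<le> \<theta> * N v + \<kappa> / R / 4 * N v"
      using t V [unfolded e] mult_left_mono [OF EN(1) [of v] \<theta>(1)] by linarith
    also have "\<dots> = (1 - 3 / 4 * (\<kappa> / R)) * N v" by (simp add: \<theta>_def algebra_simps)
    finally have t': "sqrt d * \<bar>w k\<bar> \<le> (1 - 3 / 4 * (\<kappa> / R)) * N v" .
    moreover have "\<theta> * (sqrt d * \<bar>w k\<bar>) \<le> sqrt d * \<bar>w k\<bar>"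
      using \<theta> sd by (simp add: mult_left_le_one_le)
    ultimately have "E w \<le> (1 - 3 / 4 * (\<kappa> / R)) * N v + \<kappa> / R / 4 * N v"
      using u V [unfolded e] by linarith
    also have "\<dots> = (1 - \<kappa> / R / 2) * N v" by (simp add: algebra_simps)
    finally have u': "E w \<le> (1 - \<kappa> / R / 2) * N v" .
    have "(1 - 3 / 4 * (\<kappa> / R)) * N v \<le> (1 - \<kappa> / R / 2) * N v"
    proof (rule mult_right_mono [OF _ N0])
      have "0 \<le> c \<Longrightarrow> 1 - 3 / 4 * c \<le> 1 - c / 2" for c :: real by simp
      from this [of "\<kappa> / R"] show "1 - 3 / 4 * (\<kappa> / R) \<le> 1 - \<kappa> / R / 2"
        using \<kappa> R by simp
    qed
    then show ?thesis using t' u' by (simp add: N_def)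
  qed
  show thesis
  proof (rule that [of "1 - \<kappa> / R / 2" \<eta> "2 / sqrt \<kappa>" "sqrt R" N])
    show "0 \<le> 1 - \<kappa> / R / 2" "1 - \<kappa> / R / 2 < 1" using \<theta> \<kappa> R by (auto simp: \<theta>_def)
    show "l1 (Suc k) v \<le> 2 / sqrt \<kappa> * N v" for v
      using lN [of v] sk by (simp add: field_simps)
  qed (use \<eta> sk R Nl step in auto)
qed

abbreviation d1 :: "nat \<Rightarrow> real vec \<Rightarrow> real vec \<Rightarrow> real" where
  "d1 k x y \<equiv> l1 k (\<lambda>j. x $ j - y $ j)"

section \<open>The EBE step near a zero with positive definite Jacobian\<close>

definition pad :: "real vec \<Rightarrow> real vec \<Rightarrow> real vec" where
  "pad \<alpha> l = Matrix.vec (dim_vec \<alpha>) (\<lambda>k. if k < dim_vec l then l $ k else \<alpha> $ k)"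

lemma frozen_pad: "frozen \<alpha> F r l = F r (pad \<alpha> l)"
  by (simp add: frozen_def pad_def)

lemma pad_carrier [simp]: "\<alpha> \<in> carrier_vec n \<Longrightarrow> pad \<alpha> l \<in> carrier_vec n"
  by (simp add: pad_def)

lemma d1_pad:
  assumes "\<alpha> \<in> carrier_vec n" "i \<le> n" "l \<in> carrier_vec i" "m \<in> carrier_vec i"
  shows "d1 n (pad \<alpha> l) (pad \<alpha> m) = d1 i l m"
  using assms by (intro l1_zero_extend) (auto simp: pad_def)

lemma pad_update:
  assumes "\<alpha> \<in> carrier_vec n" "l \<in> carrier_vec i" "s < i"
  shows "pad \<alpha> (l |\<^sub>v s \<mapsto> t) = pad \<alpha> l |\<^sub>v s \<mapsto> t"
  using assms by (intro eq_vecI) (auto simp: pad_def update_vec_def)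

lemma snoc_vec_carrier [simp]: "v \<in> carrier_vec k \<Longrightarrow> snoc_vec v t \<in> carrier_vec (Suc k)"
  unfolding snoc_vec_def using append_carrier_vec [of v k "Matrix.vec 1 (\<lambda>_. t)" 1] by simp

lemma snoc_vec_index:
  assumes "v \<in> carrier_vec k"
  shows "j < k \<Longrightarrow> snoc_vec v t $ j = v $ j" "snoc_vec v t $ k = t"
  using assms by (auto simp: snoc_vec_def)

lemma mat_mult_vec_index:
  assumes "x \<in> carrier_vec k" "j < k"
  shows "(Matrix.mat k k (\<lambda>(j, l). B j l) *\<^sub>v x) $ j = (\<Sum>l<k. B j l * x $ l)"
  using assms by (auto simp: scalar_prod_def lessThan_atLeast0 intro!: sum.cong)

text \<open>
  The abstract setting: a system that is differentiable in each variable, strictly differentiable at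
  \<open>x\<^sub>0\<close> with Jacobian continuous at \<open>x\<^sub>0\<close>, and whose Jacobian at \<open>x\<^sub>0\<close> is symmetric positive definite.
  Strict differentiability allows linearising at \<open>x\<^sub>0\<close> the difference between the values at an iterate
  and at the target, neither of which is \<open>x\<^sub>0\<close>; this makes all estimates uniform in the frozen values.
\<close>

locale spd_zero =
  fixes n :: nat and F :: "nat \<Rightarrow> real vec \<Rightarrow> real"
    and J :: "nat \<Rightarrow> nat \<Rightarrow> real vec \<Rightarrow> real" and x0 :: "real vec"
  assumes F_deriv: "\<lbrakk>z \<in> carrier_vec n; r < n; s < n\<rbrakk> \<Longrightarrow>
      ((\<lambda>t. F r (z |\<^sub>v s \<mapsto> t)) has_real_derivative J r s z) (at (z $ s))"
    and F_strict: "0 < \<eta> \<Longrightarrow> \<exists>\<rho>>0. \<forall>z\<in>carrier_vec n. \<forall>m\<in>carrier_vec n. \<forall>r<n.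
      d1 n z x0 < \<rho> \<longrightarrow> d1 n m x0 < \<rho> \<longrightarrow>
      \<bar>F r z - F r m - (\<Sum>s<n. J r s x0 * (z $ s - m $ s))\<bar> \<le> \<eta> * d1 n z m"
    and J_cont: "0 < \<eta> \<Longrightarrow> \<exists>\<rho>>0. \<forall>z\<in>carrier_vec n. \<forall>r<n. \<forall>s<n.
      d1 n z x0 < \<rho> \<longrightarrow> \<bar>J r s z - J r s x0\<bar> \<le> \<eta>"
    and J_sym: "r < n \<Longrightarrow> s < n \<Longrightarrow> J r s x0 = J s r x0"
    and J_pos: "\<exists>\<kappa>. coercive \<kappa> n (\<lambda>r s. J r s x0)"
begin

abbreviation S :: "nat \<Rightarrow> nat \<Rightarrow> real" where
  "S r s \<equiv> J r s x0"

lemma partial_frozen: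
  assumes "\<alpha> \<in> carrier_vec n" "l \<in> carrier_vec i" "i \<le> n" "r < n" "s < i"
  shows "partial (frozen \<alpha> F r) s l = J r s (pad \<alpha> l)"
proof -
  have "pad \<alpha> l $ s = l $ s" using assms by (simp add: pad_def)
  moreover have "(\<lambda>t. frozen \<alpha> F r (l |\<^sub>v s \<mapsto> t)) = (\<lambda>t. F r (pad \<alpha> l |\<^sub>v s \<mapsto> t))"
    using assms pad_update by (auto simp: frozen_pad)
  ultimately show ?thesis
    unfolding partial_def
    using F_deriv [of "pad \<alpha> l" r s] assms by (simp add: DERIV_imp_deriv)
qed

text \<open>
  The error \<open>e\<close> after one step satisfies the two equations of a block Gauss-Seidel sweep for the
  Jacobian at \<open>x\<^sub>0\<close> up to a residual \<open>O(\<epsilon> V)\<close>, where \<open>V\<close> is the error before the step and \<open>\<epsilon>\<close> bounds the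
  variation of the Jacobian in the neighbourhood. The constants \<open>C1\<close>, \<open>C1 + C2\<close> and \<open>C3\<close> bound, relative
  to \<open>V\<close>, the errors of the new last component, of the predicted point, and of the new first block.
  They are independent of \<open>\<epsilon>\<close>, so the residuals become small by shrinking the neighbourhood alone.
\<close>

lemma block_step_residuals:
  fixes \<kappa> R \<epsilon> \<rho> :: real and k :: nat and \<alpha> m l :: "real vec"
  defines "C1 \<equiv> 2 * (R + 2) / \<kappa>"
  defines "C2 \<equiv> 1 + (C1 + 1) * (2 * (R + 1) / \<kappa>)"
  defines "C3 \<equiv> 2 * (R * C1 + 2 * C2 + C1) / \<kappa>"
  defines "G \<equiv> frozen \<alpha> F" and "V \<equiv> d1 (Suc k) l m"
  assumes k: "k < n" and S: "coercive \<kappa> n S"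
    and R: "\<And>r s. r < n \<Longrightarrow> s < n \<Longrightarrow> \<bar>S r s\<bar> \<le> R"
    and \<epsilon>: "0 < \<epsilon>" "\<epsilon> \<le> 1" "\<epsilon> \<le> \<kappa> / 2"
    and strict: "\<And>z m r. \<lbrakk>z \<in> carrier_vec n; m \<in> carrier_vec n; r < n; d1 n z x0 < \<rho>; d1 n m x0 < \<rho>\<rbrakk> \<Longrightarrow>
        \<bar>F r z - F r m - (\<Sum>s<n. S r s * (z $ s - m $ s))\<bar> \<le> \<epsilon> * d1 n z m"
    and cont: "\<And>z r s. \<lbrakk>z \<in> carrier_vec n; r < n; s < n; d1 n z x0 < \<rho>\<rbrakk> \<Longrightarrow> \<bar>J r s z - S r s\<bar> \<le> \<epsilon>"
    and \<alpha>: "\<alpha> \<in> carrier_vec n" and m: "m \<in> carrier_vec (Suc k)" and l: "l \<in> carrier_vec (Suc k)"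
    and near: "d1 n (pad \<alpha> m) x0 < \<rho> / 2" "(1 + C1 + C2) * V < \<rho> / 2"
    and zero: "\<And>r. r \<le> k \<Longrightarrow> G r m = 0"
  shows "H_defined G (Suc k) l"
    and "H_map G (Suc k) l \<in> carrier_vec (Suc k)"
    and "\<bar>S k k * (H_map G (Suc k) l $ k - m $ k) + (\<Sum>j<k. S k j * (l $ j - m $ j))\<bar>
           \<le> (2 + C1) * \<epsilon> * V"
    and "j < k \<Longrightarrow>
         \<bar>(\<Sum>s<k. S j s * (H_map G (Suc k) l $ s - m $ s)) + S j k * (H_map G (Suc k) l $ k - m $ k)\<bar>
           \<le> (2 * C2 + C1 + C3) * \<epsilon> * V"
proof -
  have \<kappa>: "0 < \<kappa>" using S by (simp add: coercive_def)
  have R0: "0 < R" using coercive_diag [OF S k] R [OF k k] \<kappa> by linarith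
  have Sk: "coercive \<kappa> k S" by (rule coercive_mono [OF S]) (use k in simp)
  have C1: "0 \<le> C1" using R0 \<kappa> by (simp add: C1_def)
  have C2: "1 \<le> C2" using C1 R0 \<kappa> by (simp add: C2_def)
  have V0: "0 \<le> V" by (simp add: V_def)
  have lin: "\<bar>G r l' - (\<Sum>s<Suc k. S r s * (l' $ s - m $ s))\<bar> \<le> \<epsilon> * d1 (Suc k) l' m"
    and jac: "s < n \<Longrightarrow> \<bar>J r s (pad \<alpha> l') - S r s\<bar> \<le> \<epsilon>"
    if l': "l' \<in> carrier_vec (Suc k)" "d1 (Suc k) l' m < \<rho> / 2" and r: "r \<le> k" for l' r s
  proof -
    have eq: "d1 n (pad \<alpha> l') (pad \<alpha> m) = d1 (Suc k) l' m"
      using \<alpha> m l' k by (intro d1_pad) auto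
    have d: "d1 n (pad \<alpha> l') x0 < \<rho>"
      using l1_triangle [of n "\<lambda>j. pad \<alpha> l' $ j" "\<lambda>j. x0 $ j" "\<lambda>j. pad \<alpha> m $ j"] eq near l' by simp
    have d': "d1 n (pad \<alpha> m) x0 < \<rho>"
      using near(1) l1_nonneg [of n "\<lambda>j. pad \<alpha> m $ j - x0 $ j"] by linarith
    have "(\<Sum>s<n. S r s * (pad \<alpha> l' $ s - pad \<alpha> m $ s)) = (\<Sum>s<Suc k. S r s * (pad \<alpha> l' $ s - pad \<alpha> m $ s))"
      using \<alpha> m l' k by (intro sum.mono_neutral_right) (auto simp: pad_def)
    also have "\<dots> = (\<Sum>s<Suc k. S r s * (l' $ s - m $ s))"
      using \<alpha> m l' k by (intro sum.cong refl) (auto simp: pad_def)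
    finally show "\<bar>G r l' - (\<Sum>s<Suc k. S r s * (l' $ s - m $ s))\<bar> \<le> \<epsilon> * d1 (Suc k) l' m"
      using strict [of "pad \<alpha> l'" "pad \<alpha> m" r] \<alpha> r k d d' eq zero [OF r]
      by (simp add: G_def frozen_pad)
    show "\<bar>J r s (pad \<alpha> l') - S r s\<bar> \<le> \<epsilon>" if "s < n"
      using cont [of "pad \<alpha> l'" r s] \<alpha> r k d that by simp
  qed
  have part: "partial (G r) s l' = J r s (pad \<alpha> l')"
    if "l' \<in> carrier_vec (Suc k)" "r \<le> k" "s \<le> k" for l' r s
    unfolding G_def by (rule partial_frozen) (use that \<alpha> k in auto)
  have jac_eq: "jac G k l' = Matrix.mat k k (\<lambda>(r, s). J r s (pad \<alpha> l'))"
    if "l' \<in> carrier_vec (Suc k)" for l'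
    unfolding jac_def by (intro cong_mat) (auto simp: part that)
  have lV: "d1 (Suc k) l m < \<rho> / 2"
  proof -
    have "V * 1 \<le> V * (1 + C1 + C2)" using C1 C2 V0 by (intro mult_left_mono) auto
    then show ?thesis using near(2) V_def by (simp add: mult.commute)
  qed
  define v where "v j = l $ j - m $ j" for j
  then have "v = (\<lambda>j. l $ j - m $ j)" by blast
  then have vV: "l1 k v + \<bar>v k\<bar> = V" by (simp add: V_def l1_Suc)
  have vk: "\<bar>v k\<bar> \<le> V" "l1 k v \<le> V" using vV l1_nonneg [of k v] by linarith+
  \<comment> \<open>The Newton correction divides by \<open>D\<close> instead of \<open>S\<^sub>k\<^sub>k\<close>; the two differ by at most \<open>\<epsilon>\<close>.\<close>
  define D where "D = J k k (pad \<alpha> l)"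
  have D: "\<bar>D - S k k\<bar> \<le> \<epsilon>" unfolding D_def using jac [OF l lV] k by simp
  have D2: "\<kappa> / 2 \<le> D" using D coercive_diag [OF S k] \<epsilon> by linarith
  define T where "T = H2 G (Suc k) l"
  define \<tau> where "\<tau> = T - m $ k"
  have "T = l $ k - inverse D * G k l"
    by (simp add: T_def H2_def part l D_def)
  then have D\<tau>: "D * \<tau> = D * v k - G k l"
    using D2 \<kappa> by (simp add: \<tau>_def v_def field_simps)
  have Gk: "\<bar>G k l - ((\<Sum>j<k. S k j * v j) + S k k * v k)\<bar> \<le> \<epsilon> * V"
    using lin [OF l lV, of k] by (simp add: V_def v_def)
  have Dv: "\<bar>(D - S k k) * v k\<bar> \<le> \<epsilon> * V"
    unfolding abs_mult by (intro mult_mono D vk) (use \<epsilon> in auto)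
  have pk: "\<bar>\<Sum>j<k. S k j * v j\<bar> \<le> R * V"
  proof -
    have "\<bar>\<Sum>j<k. S k j * v j\<bar> \<le> R * l1 k v" using R k by (intro pairing_le) auto
    also have "\<dots> \<le> R * V" using vk R0 by (intro mult_left_mono) auto
    finally show ?thesis .
  qed
  have \<tau>V: "\<bar>\<tau>\<bar> \<le> C1 * V"
  proof -
    have "D * \<tau> = (D - S k k) * v k - (\<Sum>j<k. S k j * v j)
        - (G k l - ((\<Sum>j<k. S k j * v j) + S k k * v k))"
      using D\<tau> by (simp add: algebra_simps)
    then have "\<bar>D * \<tau>\<bar> \<le> \<epsilon> * V + R * V + \<epsilon> * V"
      using Dv pk Gk by linarith
    also have "\<dots> \<le> (R + 2) * V"
      using mult_right_mono [OF \<epsilon>(2) V0] by (simp add: algebra_simps)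
    finally have "D * \<bar>\<tau>\<bar> \<le> (R + 2) * V"
      using D2 \<kappa> by (simp add: abs_mult)
    moreover have "\<kappa> / 2 * \<bar>\<tau>\<bar> \<le> D * \<bar>\<tau>\<bar>" by (rule mult_right_mono [OF D2]) simp
    ultimately have "\<kappa> / 2 * \<bar>\<tau>\<bar> \<le> (R + 2) * V" by linarith
    then show ?thesis using \<kappa> by (simp add: C1_def field_simps)
  qed
  have res1: "\<bar>S k k * \<tau> + (\<Sum>j<k. S k j * v j)\<bar> \<le> (2 + C1) * \<epsilon> * V"
  proof -
    have "S k k * \<tau> + (\<Sum>j<k. S k j * v j) = (D - S k k) * v k - (D - S k k) * \<tau>
        - (G k l - ((\<Sum>j<k. S k j * v j) + S k k * v k))"
      using D\<tau> by (simp add: algebra_simps)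
    moreover have "\<bar>(D - S k k) * \<tau>\<bar> \<le> \<epsilon> * (C1 * V)"
      unfolding abs_mult by (intro mult_mono D \<tau>V) (use \<epsilon> in auto)
    ultimately have "\<bar>S k k * \<tau> + (\<Sum>j<k. S k j * v j)\<bar> \<le> \<epsilon> * V + \<epsilon> * (C1 * V) + \<epsilon> * V"
      using Dv Gk by linarith
    then show ?thesis by (simp add: algebra_simps)
  qed
  \<comment> \<open>Of the predictor only the size of its error matters, because the corrector below cancels it to first order.\<close>
  define x where "x = mat_inv (jac G k l) *\<^sub>v Matrix.vec k (\<lambda>r. partial (G r) k l)"
  have B: "\<bar>J r s (pad \<alpha> l) - S r s\<bar> \<le> \<kappa> / 2" if "r < k" "s < k" for r s
    using jac [OF l lV, of r s] that k \<epsilon> by simp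
  note inv = perturbed_invertible [OF Sk, of "\<lambda>r s. J r s (pad \<alpha> l)", OF B, folded jac_eq [OF l]]
  have x: "x \<in> carrier_vec k"
    unfolding x_def by (rule mult_mat_vec_carrier [OF inv(2)]) auto
  have jx: "jac G k l *\<^sub>v x = Matrix.vec k (\<lambda>r. partial (G r) k l)"
    unfolding x_def by (rule inv(3)) auto
  have "\<bar>\<Sum>s<k. J r s (pad \<alpha> l) * x $ s\<bar> \<le> R + 1" if "r < k" for r
  proof -
    have "(\<Sum>s<k. J r s (pad \<alpha> l) * x $ s) = partial (G r) k l"
      using mat_mult_vec_index [OF x that, of "\<lambda>r s. J r s (pad \<alpha> l)", folded jac_eq [OF l], unfolded jx]
        that by simp
    also have "\<dots> = J r k (pad \<alpha> l)" using l that by (simp add: part)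
    finally show ?thesis
      using jac [OF l lV, of r k] R [of r k] that k \<epsilon> by simp
  qed
  then have lx: "l1 k (\<lambda>j. x $ j) \<le> 2 * (R + 1) / \<kappa>"
    using R0 by (intro perturbed_solution_bound [OF Sk B]) auto
  define g where "g = ebe_g G (Suc k) l"
  have g_eq: "g = vec_first l k - (T - l $ k) \<cdot>\<^sub>v x"
    by (simp add: g_def ebe_g_def T_def x_def)
  have g: "g \<in> carrier_vec k" using x by (simp add: g_eq)
  have gj: "g $ j = l $ j - (T - l $ k) * x $ j" if "j < k" for j
    using that x l by (simp add: g_eq vec_first_def)
  define \<gamma> where "\<gamma> j = g $ j - m $ j" for j
  have \<gamma>V: "l1 k \<gamma> \<le> C2 * V"
  proof -
    have "l1 k \<gamma> = l1 k (\<lambda>j. v j - (T - l $ k) * x $ j)"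
      by (rule l1_cong) (simp add: \<gamma>_def gj v_def)
    also have "\<dots> \<le> l1 k v + l1 k (\<lambda>j. (T - l $ k) * x $ j)"
      unfolding l1_def sum.distrib [symmetric] by (intro sum_mono) linarith
    also have "\<dots> = l1 k v + \<bar>T - l $ k\<bar> * l1 k (\<lambda>j. x $ j)" by (simp add: l1_mult)
    also have "\<bar>T - l $ k\<bar> * l1 k (\<lambda>j. x $ j) \<le> ((C1 + 1) * V) * (2 * (R + 1) / \<kappa>)"
    proof (intro mult_mono lx)
      have "\<bar>T - l $ k\<bar> \<le> \<bar>\<tau>\<bar> + \<bar>v k\<bar>" by (simp add: \<tau>_def v_def)
      then show "\<bar>T - l $ k\<bar> \<le> (C1 + 1) * V" using \<tau>V vk by (simp add: distrib_right)
    qed (use C1 V0 in auto)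
    finally have "l1 k \<gamma> \<le> V + ((C1 + 1) * V) * (2 * (R + 1) / \<kappa>)" using vk by linarith
    also have "\<dots> = C2 * V" by (simp add: C2_def algebra_simps)
    finally show ?thesis .
  qed
  \<comment> \<open>In \<open>J(y) e = J(y) \<gamma> - G(y)\<close> the expansion of \<open>G(y)\<close> contains \<open>S \<gamma>\<close>, so the predictor error \<open>\<gamma>\<close> survives only with the factor \<open>J(y) - S = O(\<epsilon>)\<close>.\<close>
  define y where "y = snoc_vec g T"
  have y: "y \<in> carrier_vec (Suc k)" using g by (simp add: y_def)
  have yd: "d1 (Suc k) y m \<le> (C1 + C2) * V"
  proof -
    have "d1 (Suc k) y m = l1 k \<gamma> + \<bar>\<tau>\<bar>"
      unfolding l1_Suc using snoc_vec_index [OF g] by (auto simp: y_def \<gamma>_def \<tau>_def intro!: l1_cong)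
    then show ?thesis using \<gamma>V \<tau>V by (simp add: distrib_right)
  qed
  have yV: "d1 (Suc k) y m < \<rho> / 2"
  proof -
    have "(C1 + C2) * V \<le> (1 + C1 + C2) * V" using V0 by (intro mult_right_mono) auto
    then show ?thesis using near(2) yd by linarith
  qed
  have B': "\<bar>J r s (pad \<alpha> y) - S r s\<bar> \<le> \<kappa> / 2" if "r < k" "s < k" for r s
    using jac [OF y yV, of r s] that k \<epsilon> by simp
  note inv' = perturbed_invertible [OF Sk, of "\<lambda>r s. J r s (pad \<alpha> y)", OF B', folded jac_eq [OF y]]
  show "H_defined G (Suc k) l"
    unfolding H_defined_def using inv(1) inv'(1) D2 \<kappa>
    by (simp add: part l D_def [symmetric] g_def [symmetric] T_def [symmetric] y_def [symmetric])
  define p where "p = mat_inv (jac G k y) *\<^sub>v sys G k y"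
  have p: "p \<in> carrier_vec k"
    unfolding p_def by (rule mult_mat_vec_carrier [OF inv'(2)]) (auto simp: sys_def)
  have jp: "jac G k y *\<^sub>v p = sys G k y"
    unfolding p_def by (rule inv'(3)) (auto simp: sys_def)
  have gp: "g - p \<in> carrier_vec k" using g p by simp
  have H_eq: "H_map G (Suc k) l = snoc_vec (g - p) T"
    by (simp add: H_map_def H1_def Let_def g_def T_def y_def p_def)
  show "H_map G (Suc k) l \<in> carrier_vec (Suc k)" using gp by (simp add: H_eq)
  define e where "e j = H_map G (Suc k) l $ j - m $ j" for j
  have ek: "e k = \<tau>" using snoc_vec_index(2) [OF gp] by (simp add: e_def H_eq \<tau>_def)
  have ej: "e j = \<gamma> j - p $ j" if "j < k" for j
    using snoc_vec_index(1) [OF gp that] g p that by (simp add: e_def H_eq \<gamma>_def)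
  show "\<bar>S k k * (H_map G (Suc k) l $ k - m $ k) + (\<Sum>j<k. S k j * (l $ j - m $ j))\<bar>
           \<le> (2 + C1) * \<epsilon> * V"
    using res1 ek by (simp add: e_def v_def)
  have r0: "\<bar>(\<Sum>s<k. J r s (pad \<alpha> y) * e s) + S r k * \<tau>\<bar> \<le> \<epsilon> * ((2 * C2 + C1) * V)"
    if r: "r < k" for r
  proof -
    have "(\<Sum>s<k. J r s (pad \<alpha> y) * p $ s) = G r y"
      using mat_mult_vec_index [OF p r, of "\<lambda>r s. J r s (pad \<alpha> y)", folded jac_eq [OF y], unfolded jp]
        r by (simp add: sys_def)
    moreover have "(\<Sum>s<k. J r s (pad \<alpha> y) * e s)
        = (\<Sum>s<k. J r s (pad \<alpha> y) * \<gamma> s) - (\<Sum>s<k. J r s (pad \<alpha> y) * p $ s)"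
      unfolding sum_subtractf [symmetric] by (intro sum.cong refl) (simp add: ej right_diff_distrib)
    moreover have "(\<Sum>s<k. (J r s (pad \<alpha> y) - S r s) * \<gamma> s)
        = (\<Sum>s<k. J r s (pad \<alpha> y) * \<gamma> s) - (\<Sum>s<k. S r s * \<gamma> s)"
      by (simp add: left_diff_distrib sum_subtractf)
    moreover have "(\<Sum>s<Suc k. S r s * (y $ s - m $ s)) = (\<Sum>s<k. S r s * \<gamma> s) + S r k * \<tau>"
      using snoc_vec_index [OF g] by (simp add: y_def \<gamma>_def \<tau>_def)
    moreover have "\<bar>G r y - (\<Sum>s<Suc k. S r s * (y $ s - m $ s))\<bar> \<le> \<epsilon> * ((C1 + C2) * V)"
    proof -
      have "\<epsilon> * d1 (Suc k) y m \<le> \<epsilon> * ((C1 + C2) * V)" using yd \<epsilon> by (intro mult_left_mono) auto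
      then show ?thesis using lin [OF y yV, of r] r by linarith
    qed
    moreover have "\<bar>\<Sum>s<k. (J r s (pad \<alpha> y) - S r s) * \<gamma> s\<bar> \<le> \<epsilon> * (C2 * V)"
    proof -
      have "\<bar>\<Sum>s<k. (J r s (pad \<alpha> y) - S r s) * \<gamma> s\<bar> \<le> \<epsilon> * l1 k \<gamma>"
        using jac [OF y yV] r k by (intro pairing_le) auto
      also have "\<dots> \<le> \<epsilon> * (C2 * V)" using \<gamma>V \<epsilon> by (intro mult_left_mono) auto
      finally show ?thesis .
    qed
    ultimately have "\<bar>(\<Sum>s<k. J r s (pad \<alpha> y) * e s) + S r k * \<tau>\<bar>
        \<le> \<epsilon> * (C2 * V) + \<epsilon> * ((C1 + C2) * V)" by linarith
    then show ?thesis by (simp add: algebra_simps)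
  qed
  have "\<bar>\<Sum>s<k. J r s (pad \<alpha> y) * e s\<bar> \<le> (R * C1 + 2 * C2 + C1) * V" if r: "r < k" for r
  proof -
    have "\<bar>S r k * \<tau>\<bar> \<le> R * (C1 * V)"
      unfolding abs_mult using R [of r k] r k R0 by (intro mult_mono \<tau>V) auto
    moreover have "\<epsilon> * ((2 * C2 + C1) * V) \<le> 1 * ((2 * C2 + C1) * V)"
      using \<epsilon> C1 C2 V0 by (intro mult_right_mono) auto
    ultimately have "\<bar>\<Sum>s<k. J r s (pad \<alpha> y) * e s\<bar> \<le> R * (C1 * V) + (2 * C2 + C1) * V"
      using r0 [OF r] by linarith
    then show ?thesis by (simp add: algebra_simps)
  qed
  then have "l1 k e \<le> 2 * ((R * C1 + 2 * C2 + C1) * V) / \<kappa>"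
    using R0 C1 C2 V0 by (intro perturbed_solution_bound [OF Sk B']) auto
  then have eV: "l1 k e \<le> C3 * V" by (simp only: C3_def times_divide_eq_left mult.assoc)
  show "\<bar>(\<Sum>s<k. S j s * (H_map G (Suc k) l $ s - m $ s)) + S j k * (H_map G (Suc k) l $ k - m $ k)\<bar>
           \<le> (2 * C2 + C1 + C3) * \<epsilon> * V" if j: "j < k" for j
  proof -
    have "\<bar>\<Sum>s<k. (J j s (pad \<alpha> y) - S j s) * e s\<bar> \<le> \<epsilon> * l1 k e"
      using jac [OF y yV] j k by (intro pairing_le) auto
    also have "\<dots> \<le> \<epsilon> * (C3 * V)" using eV \<epsilon> by (intro mult_left_mono) auto
    finally have "\<bar>\<Sum>s<k. (J j s (pad \<alpha> y) - S j s) * e s\<bar> \<le> \<epsilon> * (C3 * V)" .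
    moreover have "(\<Sum>s<k. (J j s (pad \<alpha> y) - S j s) * e s)
        = (\<Sum>s<k. J j s (pad \<alpha> y) * e s) - (\<Sum>s<k. S j s * e s)"
      by (simp add: left_diff_distrib sum_subtractf)
    ultimately have "\<bar>(\<Sum>s<k. S j s * e s) + S j k * \<tau>\<bar>
        \<le> \<epsilon> * ((2 * C2 + C1) * V) + \<epsilon> * (C3 * V)"
      using r0 [OF j] by linarith
    then show ?thesis using ek by (simp add: e_def algebra_simps)
  qed
qed

end

lemma vdist_le_d1: "vdist i x y \<le> d1 i x y"
  unfolding vdist_def l1_def by (rule L2_set_le_sum_abs)

lemma d1_le_vdist: "d1 i x y \<le> real i * vdist i x y"
proof -
  have "\<bar>x $ j - y $ j\<bar> \<le> vdist i x y" if "j < i" for j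
    unfolding vdist_def using member_le_L2_set [of "{..<i}" j "\<lambda>k. \<bar>x $ k - y $ k\<bar>"] that
    by (simp add: L2_set_def)
  then show ?thesis
    unfolding l1_def using sum_bounded_above [of "{..<i}" "\<lambda>j. \<bar>x $ j - y $ j\<bar>" "vdist i x y"] by simp
qed

text \<open>
  For \<open>k = 0\<close> the first block of \<^const>\<open>H_map\<close> is empty and the map is Newton's, so step 1 needs no
  separate convergence proof.
\<close>

lemma ebe_map_eq_H_map:
  assumes "l \<in> carrier_vec (Suc k)" "H_defined G (Suc k) l" "H_map G (Suc k) l \<in> carrier_vec (Suc k)"
  shows "ebe_defined G (Suc k) l" "ebe_map G (Suc k) l = H_map G (Suc k) l"
proof -
  show "ebe_defined G (Suc k) l"
    using assms(2) unfolding ebe_defined_def H_defined_def by (cases k) simp_all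
  show "ebe_map G (Suc k) l = H_map G (Suc k) l"
  proof (cases "k = 0")
    case True
    have "dim_vec (H_map G 1 l) = 1" using assms(3) True by simp
    then have "H1 G 1 l \<in> carrier_vec 0"
      unfolding H_map_def snoc_vec_def by (intro carrier_vecI) simp
    then have "H_map G 1 l $ 0 = H2 G 1 l"
      unfolding H_map_def by (rule snoc_vec_index(2))
    then have "newton_map G l $ 0 = H_map G 1 l $ 0"
      by (simp add: newton_map_def H2_def)
    then have "newton_map G l = H_map G 1 l"
      using \<open>dim_vec (H_map G 1 l) = 1\<close> by (intro eq_vecI) (simp_all add: newton_map_def)
    then show ?thesis using True by (simp add: ebe_map_def)
  next
    case False
    then show ?thesis by (simp add: ebe_map_def)
  qed
qed

context spd_zero
begin

text \<open>
  The relative residuals of \<open>block_step_residuals\<close> are at most \<open>M \<epsilon>\<close> for a constant \<open>M\<close>, and continuity of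
  the Jacobian makes \<open>\<epsilon>\<close> as small as desired.
\<close>

lemma block_step_small_residuals:
  assumes k: "k < n" and \<eta>: "0 < \<eta>"
  obtains \<rho> where "0 < \<rho>"
    "\<And>\<alpha> m l. \<lbrakk>\<alpha> \<in> carrier_vec n; m \<in> carrier_vec (Suc k); l \<in> carrier_vec (Suc k);
        d1 n (pad \<alpha> m) x0 < \<rho>; d1 (Suc k) l m < \<rho>; \<And>r. r \<le> k \<Longrightarrow> frozen \<alpha> F r m = 0\<rbrakk> \<Longrightarrow>
      H_defined (frozen \<alpha> F) (Suc k) l \<and> H_map (frozen \<alpha> F) (Suc k) l \<in> carrier_vec (Suc k) \<and>
      \<bar>S k k * (H_map (frozen \<alpha> F) (Suc k) l $ k - m $ k) + (\<Sum>j<k. S k j * (l $ j - m $ j))\<bar>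
        \<le> \<eta> * d1 (Suc k) l m \<and>
      (\<forall>j<k. \<bar>(\<Sum>s<k. S j s * (H_map (frozen \<alpha> F) (Suc k) l $ s - m $ s))
                + S j k * (H_map (frozen \<alpha> F) (Suc k) l $ k - m $ k)\<bar> \<le> \<eta> * d1 (Suc k) l m)"
proof -
  obtain \<kappa> where S: "coercive \<kappa> n S" using J_pos by auto
  then have \<kappa>: "0 < \<kappa>" by (simp add: coercive_def)
  define R where "R = (\<Sum>r<n. \<Sum>s<n. \<bar>S r s\<bar>)"
  have R: "\<bar>S r s\<bar> \<le> R" if "r < n" "s < n" for r s
  proof -
    have "\<bar>S r s\<bar> \<le> (\<Sum>s<n. \<bar>S r s\<bar>)"
      by (rule member_le_sum) (use that in auto)
    also have "\<dots> \<le> R"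
      unfolding R_def by (rule member_le_sum [of r _ "\<lambda>r. \<Sum>s<n. \<bar>S r s\<bar>"])
        (use that in \<open>auto intro!: sum_nonneg\<close>)
    finally show ?thesis .
  qed
  have R0: "0 \<le> R" by (simp add: R_def sum_nonneg)
  define C1 where "C1 = 2 * (R + 2) / \<kappa>"
  define C2 where "C2 = 1 + (C1 + 1) * (2 * (R + 1) / \<kappa>)"
  define C3 where "C3 = 2 * (R * C1 + 2 * C2 + C1) / \<kappa>"
  have C: "0 \<le> C1" "0 \<le> C2" "0 \<le> C3"
    using \<kappa> R0 by (simp_all add: C1_def C2_def C3_def)
  define M where "M = 2 + C1 + 2 * C2 + C1 + C3"
  have M: "0 < M" "2 + C1 \<le> M" "2 * C2 + C1 + C3 \<le> M" using C by (auto simp: M_def)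
  define \<epsilon> where "\<epsilon> = min (min 1 (\<kappa> / 2)) (\<eta> / M)"
  have \<epsilon>: "0 < \<epsilon>" "\<epsilon> \<le> 1" "\<epsilon> \<le> \<kappa> / 2" "\<epsilon> \<le> \<eta> / M"
  proof -
    show "0 < \<epsilon>" "\<epsilon> \<le> 1" "\<epsilon> \<le> \<eta> / M" using \<kappa> \<eta> M(1) by (simp_all add: \<epsilon>_def)
    have "\<epsilon> \<le> min 1 (\<kappa> / 2)" unfolding \<epsilon>_def by (rule min.cobounded1)
    then show "\<epsilon> \<le> \<kappa> / 2" by (rule order_trans) (rule min.cobounded2)
  qed
  have M\<epsilon>: "M * \<epsilon> \<le> \<eta>"
    using \<epsilon>(4) M(1) by (simp add: pos_le_divide_eq mult.commute)
  obtain \<rho>1 where \<rho>1: "0 < \<rho>1" "\<And>z m r. \<lbrakk>z \<in> carrier_vec n; m \<in> carrier_vec n; r < n;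
      d1 n z x0 < \<rho>1; d1 n m x0 < \<rho>1\<rbrakk> \<Longrightarrow>
      \<bar>F r z - F r m - (\<Sum>s<n. S r s * (z $ s - m $ s))\<bar> \<le> \<epsilon> * d1 n z m"
    using F_strict [OF \<epsilon>(1)] by blast
  obtain \<rho>2 where \<rho>2: "0 < \<rho>2" "\<And>z r s. \<lbrakk>z \<in> carrier_vec n; r < n; s < n; d1 n z x0 < \<rho>2\<rbrakk> \<Longrightarrow>
      \<bar>J r s z - S r s\<bar> \<le> \<epsilon>"
    using J_cont [OF \<epsilon>(1)] by blast
  define \<rho>0 where "\<rho>0 = min \<rho>1 \<rho>2"
  have \<rho>0: "0 < \<rho>0" "\<rho>0 \<le> \<rho>1" "\<rho>0 \<le> \<rho>2"
    using \<rho>1(1) \<rho>2(1) by (auto simp: \<rho>0_def)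
  define \<rho> where "\<rho> = min (\<rho>0 / 2) (\<rho>0 / 2 / (1 + C1 + C2))"
  have \<rho>: "0 < \<rho>" using \<rho>0 C by (auto simp: \<rho>_def)
  show thesis
  proof (rule that [OF \<rho>])
    fix \<alpha> m l
    assume a: "\<alpha> \<in> carrier_vec n" "m \<in> carrier_vec (Suc k)" "l \<in> carrier_vec (Suc k)"
      and d: "d1 n (pad \<alpha> m) x0 < \<rho>" "d1 (Suc k) l m < \<rho>"
      and z: "\<And>r. r \<le> k \<Longrightarrow> frozen \<alpha> F r m = 0"
    let ?V = "d1 (Suc k) l m" and ?H = "H_map (frozen \<alpha> F) (Suc k) l"
    have near: "d1 n (pad \<alpha> m) x0 < \<rho>0 / 2" "(1 + C1 + C2) * ?V < \<rho>0 / 2"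
    proof -
      show "d1 n (pad \<alpha> m) x0 < \<rho>0 / 2" using d(1) by (simp add: \<rho>_def)
      have "?V < \<rho>0 / 2 / (1 + C1 + C2)" using d(2) by (simp add: \<rho>_def)
      then show "(1 + C1 + C2) * ?V < \<rho>0 / 2"
        using C by (subst (asm) pos_less_divide_eq) (linarith, simp only: mult.commute)
    qed
    have small: "c * \<epsilon> * ?V \<le> \<eta> * ?V" if "c \<le> M" for c
    proof -
      have "c * \<epsilon> \<le> M * \<epsilon>" using that \<epsilon>(1) by (intro mult_right_mono) auto
      with M\<epsilon> show ?thesis by (intro mult_right_mono) auto
    qed
    have st: "\<bar>F r z - F r m - (\<Sum>s<n. S r s * (z $ s - m $ s))\<bar> \<le> \<epsilon> * d1 n z m"
      if "z \<in> carrier_vec n" "m \<in> carrier_vec n" "r < n" "d1 n z x0 < \<rho>0" "d1 n m x0 < \<rho>0" for z m r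
      using \<rho>1(2) [OF that(1-3)] that \<rho>0 by simp
    have ct: "\<bar>J r s z - S r s\<bar> \<le> \<epsilon>" if "z \<in> carrier_vec n" "r < n" "s < n" "d1 n z x0 < \<rho>0" for z r s
      using \<rho>2(2) [OF that(1-3)] that \<rho>0 by simp
    note step = block_step_residuals [OF k S R \<epsilon>(1-3) st ct a near [unfolded C1_def C2_def] z,
        folded C1_def, folded C2_def, folded C3_def]
    show "H_defined (frozen \<alpha> F) (Suc k) l \<and> ?H \<in> carrier_vec (Suc k) \<and>
      \<bar>S k k * (?H $ k - m $ k) + (\<Sum>j<k. S k j * (l $ j - m $ j))\<bar> \<le> \<eta> * ?V \<and>
      (\<forall>j<k. \<bar>(\<Sum>s<k. S j s * (?H $ s - m $ s)) + S j k * (?H $ k - m $ k)\<bar> \<le> \<eta> * ?V)"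
      by (intro conjI allI impI step(1,2) order_trans [OF step(3) small [OF M(2)]]
          order_trans [OF step(4) small [OF M(3)]])
  qed
qed

text \<open>
  Iterating the contraction: the error in the norm \<open>N\<close> never grows, so the iterates stay where
  the residual estimate applies, and it decays like \<open>q\<^sup>i\<close>. The radius \<open>\<rho>\<close> depends on \<open>x\<^sub>0\<close> and \<open>k\<close> but not
  on \<open>\<alpha>\<close> or on the target \<open>m\<close>, which is what permits one \<open>\<delta>\<close> for all initial conditions.
\<close>

lemma ebe_step_converges_locally:
  assumes k: "k < n"
  obtains \<rho> where "0 < \<rho>"
    "\<And>\<alpha> m s. \<lbrakk>\<alpha> \<in> carrier_vec n; m \<in> carrier_vec (Suc k); s \<in> carrier_vec (Suc k);
        d1 n (pad \<alpha> m) x0 < \<rho>; d1 (Suc k) s m < \<rho>; \<And>r. r \<le> k \<Longrightarrow> frozen \<alpha> F r m = 0\<rbrakk> \<Longrightarrow>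
      ebe_step_converges (frozen \<alpha> F) (Suc k) s m"
proof -
  obtain \<kappa> where "coercive \<kappa> n S" using J_pos by auto
  then have S: "coercive \<kappa> (Suc k) S" using k by (auto intro: coercive_mono)
  have sym: "S j k = S k j" if "j < k" for j
    using J_sym [of j k] k that by simp
  obtain N :: "(nat \<Rightarrow> real) \<Rightarrow> real" and q \<eta> a b where
    q: "0 \<le> q" "q < 1" and \<eta>: "0 < \<eta>" and ab: "0 < a" "0 < b"
    and N: "\<And>v. l1 (Suc k) v \<le> a * N v" "\<And>v. N v \<le> b * l1 (Suc k) v"
    and contr: "\<And>v w. \<bar>S k k * w k + (\<Sum>j<k. S k j * v j)\<bar> \<le> \<eta> * l1 (Suc k) v \<Longrightarrow>
        (\<And>j. j < k \<Longrightarrow> \<bar>(\<Sum>l<k. S j l * w l) + S j k * w k\<bar> \<le> \<eta> * l1 (Suc k) v) \<Longrightarrow>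
        N w \<le> q * N v"
  proof -
    show thesis
    proof (rule gauss_seidel_contraction [OF S sym], assumption, goal_cases)
      case (1 N q \<eta> a b)
      show thesis by (rule that; fact 1)
    qed
  qed
  obtain \<rho>0 where \<rho>0: "0 < \<rho>0"
    "\<And>\<alpha> m l. \<lbrakk>\<alpha> \<in> carrier_vec n; m \<in> carrier_vec (Suc k); l \<in> carrier_vec (Suc k);
        d1 n (pad \<alpha> m) x0 < \<rho>0; d1 (Suc k) l m < \<rho>0; \<And>r. r \<le> k \<Longrightarrow> frozen \<alpha> F r m = 0\<rbrakk> \<Longrightarrow>
      H_defined (frozen \<alpha> F) (Suc k) l \<and> H_map (frozen \<alpha> F) (Suc k) l \<in> carrier_vec (Suc k) \<and>
      \<bar>S k k * (H_map (frozen \<alpha> F) (Suc k) l $ k - m $ k) + (\<Sum>j<k. S k j * (l $ j - m $ j))\<bar>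
        \<le> \<eta> * d1 (Suc k) l m \<and>
      (\<forall>j<k. \<bar>(\<Sum>s<k. S j s * (H_map (frozen \<alpha> F) (Suc k) l $ s - m $ s))
                + S j k * (H_map (frozen \<alpha> F) (Suc k) l $ k - m $ k)\<bar> \<le> \<eta> * d1 (Suc k) l m)"
  proof -
    show thesis
    proof (rule block_step_small_residuals [OF k \<eta>], goal_cases)
      case (1 \<rho>)
      show thesis by (rule that; fact 1)
    qed
  qed
  define \<rho> where "\<rho> = min \<rho>0 (\<rho>0 / (a * b))"
  have \<rho>: "0 < \<rho>" "\<rho> \<le> \<rho>0" "a * b * \<rho> \<le> \<rho>0"
  proof -
    show "0 < \<rho>" "\<rho> \<le> \<rho>0" using \<rho>0(1) ab by (simp_all add: \<rho>_def)
    have "a * b * \<rho> \<le> a * b * (\<rho>0 / (a * b))"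
      by (rule mult_left_mono) (use ab in \<open>simp_all add: \<rho>_def\<close>)
    then show "a * b * \<rho> \<le> \<rho>0" using ab by simp
  qed
  show thesis
  proof (rule that [OF \<rho>(1)])
    fix \<alpha> m s
    assume \<alpha>: "\<alpha> \<in> carrier_vec n" and m: "m \<in> carrier_vec (Suc k)" and s: "s \<in> carrier_vec (Suc k)"
      and dm: "d1 n (pad \<alpha> m) x0 < \<rho>" and ds: "d1 (Suc k) s m < \<rho>"
      and zero: "\<And>r. r \<le> k \<Longrightarrow> frozen \<alpha> F r m = 0"
    let ?G = "frozen \<alpha> F"
    define x where "x i = (H_map ?G (Suc k) ^^ i) s" for i
    have x0: "x 0 = s" by (simp add: x_def)
    have xS: "x (Suc i) = H_map ?G (Suc k) (x i)" for i by (simp add: x_def)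
    define E where "E l = N (\<lambda>j. l $ j - m $ j)" for l
    have E0: "0 \<le> E l" for l
    proof -
      have "0 \<le> a * E l" unfolding E_def using l1_nonneg N(1) by (rule order_trans)
      then show ?thesis using ab by (simp add: zero_le_mult_iff)
    qed
    have close: "d1 (Suc k) l m < \<rho>0" if "E l \<le> E s" for l
    proof -
      have "d1 (Suc k) l m \<le> a * E l" unfolding E_def by (rule N)
      also have "\<dots> \<le> a * E s" using that ab by simp
      also have "\<dots> \<le> a * (b * d1 (Suc k) s m)" unfolding E_def using N(2) ab by simp
      also have "\<dots> < a * (b * \<rho>)" using ds ab by simp
      finally show ?thesis using \<rho>(3) by (simp add: mult.assoc)
    qed
    have one: "H_defined ?G (Suc k) l \<and> H_map ?G (Suc k) l \<in> carrier_vec (Suc k) \<and>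
        E (H_map ?G (Suc k) l) \<le> q * E l"
      if l: "l \<in> carrier_vec (Suc k)" "E l \<le> E s" for l
    proof -
      have "d1 n (pad \<alpha> m) x0 < \<rho>0" using dm \<rho>(2) by simp
      note step = \<rho>0(2) [OF \<alpha> m l(1) this close [OF l(2)] zero]
      have "E (H_map ?G (Suc k) l) \<le> q * E l"
        unfolding E_def by (rule contr) (use step in auto)
      then show ?thesis using step by simp
    qed
    have inv: "x i \<in> carrier_vec (Suc k) \<and> E (x i) \<le> q ^ i * E s" for i
    proof (induction i)
      case 0
      show ?case using s by (simp add: x0)
    next
      case (Suc i)
      have "q ^ i * E s \<le> 1 * E s" using q E0 by (intro mult_right_mono power_le_one) auto
      then have "E (x i) \<le> E s" using Suc by linarith
      note 1 = one [OF conjunct1 [OF Suc] this]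
      have "q * E (x i) \<le> q * (q ^ i * E s)" using Suc q by (intro mult_left_mono) auto
      then show ?case using 1 by (simp add: xS mult.assoc)
    qed
    have le: "E (x i) \<le> E s" for i
    proof -
      have "q ^ i * E s \<le> 1 * E s" using q E0 by (intro mult_right_mono power_le_one) auto
      then show ?thesis using inv [of i] by linarith
    qed
    have ebe: "ebe_defined ?G (Suc k) (x i) \<and> x (Suc i) = ebe_map ?G (Suc k) (x i)" for i
    proof -
      note 1 = one [OF conjunct1 [OF inv] le, of i]
      show ?thesis using ebe_map_eq_H_map [of "x i" k ?G] 1 inv [of i] by (simp add: xS)
    qed
    have lim: "(\<lambda>i. a * (q ^ i * E s)) \<longlonglongrightarrow> 0"
      using LIMSEQ_realpow_zero [OF q] by (intro tendsto_mult_right_zero tendsto_mult_left_zero)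
    have bound: "vdist (Suc k) (x i) m \<le> a * (q ^ i * E s)" for i
    proof -
      have "vdist (Suc k) (x i) m \<le> d1 (Suc k) (x i) m" by (rule vdist_le_d1)
      also have "\<dots> \<le> a * E (x i)" unfolding E_def by (rule N)
      also have "\<dots> \<le> a * (q ^ i * E s)" using inv ab by simp
      finally show ?thesis .
    qed
    have "(\<lambda>i. vdist (Suc k) (x i) m) \<longlonglongrightarrow> 0"
    proof (rule tendsto_sandwich [OF _ _ tendsto_const lim])
      show "\<forall>\<^sub>F i in sequentially. 0 \<le> vdist (Suc k) (x i) m"
        by (simp add: vdist_def L2_set_nonneg)
      show "\<forall>\<^sub>F i in sequentially. vdist (Suc k) (x i) m \<le> a * (q ^ i * E s)"
        using bound by simp
    qed
    then have "limitin (vtop (Suc k)) x m sequentially"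
      unfolding vtop_def Metric_space.limitin_metric_dist_null [OF Metric_space_vdist]
      using m inv by simp
    then show "ebe_step_converges ?G (Suc k) s m"
      unfolding ebe_step_converges_def using ebe x0 by blast
  qed
qed

end

section \<open>Systems of moment equations\<close>

lemma abs_exp_diff_le: "\<bar>exp a - exp b\<bar> \<le> exp b * (exp \<bar>a - b\<bar> - 1)" for a b :: real
proof -
  have "\<bar>exp t - 1\<bar> \<le> exp \<bar>t\<bar> - 1" for t :: real
  proof (cases "0 \<le> t")
    case False
    then have "1 - exp t \<le> - t" "- t \<le> exp (- t) - 1"
      using exp_ge_add_one_self [of t] exp_ge_add_one_self [of "- t"] by linarith+
    then show ?thesis using False by simp
  qed simp
  then have "exp b * \<bar>exp (a - b) - 1\<bar> \<le> exp b * (exp \<bar>a - b\<bar> - 1)"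
    by (intro mult_left_mono) auto
  moreover have "exp a - exp b = exp b * (exp (a - b) - 1)"
    by (simp add: right_diff_distrib flip: exp_add)
  ultimately show ?thesis by (simp add: abs_mult)
qed

text \<open>
  The mean value inequality for \<open>x \<mapsto> exp x - exp \<beta> \<cdot> x\<close>. Integrated over the domain it yields the
  differentiability of the moments, including strict differentiability, without differentiating
  under the integral sign.
\<close>

lemma exp_secant_le:
  fixes a b \<beta> \<rho> :: real
  assumes "\<bar>a - \<beta>\<bar> \<le> \<rho>" "\<bar>b - \<beta>\<bar> \<le> \<rho>"
  shows "\<bar>exp a - exp b - exp \<beta> * (a - b)\<bar> \<le> exp \<beta> * (exp \<rho> - 1) * \<bar>a - b\<bar>"
proof -
  let ?I = "{\<beta> - \<rho>..\<beta> + \<rho>}"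
  have "norm ((exp a - exp \<beta> * a) - (exp b - exp \<beta> * b)) \<le> (exp \<beta> * (exp \<rho> - 1)) * norm (a - b)"
  proof (rule field_differentiable_bound [of ?I "\<lambda>x. exp x - exp \<beta> * x" "\<lambda>x. exp x - exp \<beta>"])
    show "((\<lambda>x. exp x - exp \<beta> * x) has_field_derivative exp x - exp \<beta>) (at x within ?I)" for x
      by (auto intro!: derivative_eq_intros)
    fix x assume "x \<in> ?I"
    then have "exp \<bar>x - \<beta>\<bar> \<le> exp \<rho>" by auto
    then have "exp \<beta> * (exp \<bar>x - \<beta>\<bar> - 1) \<le> exp \<beta> * (exp \<rho> - 1)" by simp
    then show "norm (exp x - exp \<beta>) \<le> exp \<beta> * (exp \<rho> - 1)"
      unfolding real_norm_def by (rule order_trans [OF abs_exp_diff_le])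
  qed (use assms in auto)
  then show ?thesis by (simp add: algebra_simps)
qed

text \<open>
  A lower bound for the monotonicity of \<open>exp\<close> that is quadratic near 0 and still linear at infinity;
  the latter is what excludes zeros far away in \<open>frozen_zero_near\<close>.
\<close>

lemma mult_exp_minus_one_ge: "p\<^sup>2 / (1 + \<bar>p\<bar>) \<le> p * (exp p - 1)" for p :: real
proof (cases "0 \<le> p")
  case True
  have "p\<^sup>2 / (1 + \<bar>p\<bar>) \<le> p\<^sup>2 / 1" by (rule divide_left_mono) auto
  also have "\<dots> \<le> p * (exp p - 1)"
    using mult_left_mono [of p "exp p - 1" p] True exp_ge_add_one_self [of p]
    by (simp add: power2_eq_square)
  finally show ?thesis .
next
  case False
  have "1 - p \<le> exp (- p)" using exp_ge_add_one_self [of "- p"] by simp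
  then have "exp p \<le> 1 / (1 - p)"
    using False by (simp add: exp_minus field_simps)
  then have "- p * (1 - 1 / (1 - p)) \<le> - p * (1 - exp p)"
    using False by (intro mult_left_mono) auto
  moreover have "- p * (1 - 1 / (1 - p)) = p\<^sup>2 / (1 + \<bar>p\<bar>)"
    using False by (simp add: field_simps power2_eq_square)
  ultimately show ?thesis by (simp add: algebra_simps)
qed

text \<open>
  The last assumption, linear independence of the centred functions \<open>c\<^sub>k - f\<^sub>k\<close>, is equivalent to
  strict convexity of \<open>\<Phi>\<close>.
\<close>

locale exp_family =
  fixes n :: nat and a b :: "'a::euclidean_space" and c :: "nat \<Rightarrow> 'a \<Rightarrow> real" and f :: "nat \<Rightarrow> real"
  assumes cont: "k < n \<Longrightarrow> continuous_on (cbox a b) (c k)"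
    and bound: "k < n \<Longrightarrow> x \<in> cbox a b \<Longrightarrow> \<bar>c k x\<bar> \<le> 1"
    and box_ne: "box a b \<noteq> {}"
    and indep: "(\<And>x. x \<in> cbox a b \<Longrightarrow> (\<Sum>k<n. v k * (c k x - f k)) = 0) \<Longrightarrow> k < n \<Longrightarrow> v k = 0"
begin

definition expo :: "real vec \<Rightarrow> 'a \<Rightarrow> real" where
  "expo z x = (\<Sum>k<n. z $ k * c k x)"

definition moment :: "nat \<Rightarrow> real vec \<Rightarrow> real" where
  "moment r z = integral (cbox a b) (\<lambda>x. (c r x - f r) * exp (expo z x))"

definition moment_deriv :: "nat \<Rightarrow> nat \<Rightarrow> real vec \<Rightarrow> real" where
  "moment_deriv r s z = integral (cbox a b) (\<lambda>x. (c r x - f r) * c s x * exp (expo z x))"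

definition gram :: "real vec \<Rightarrow> nat \<Rightarrow> nat \<Rightarrow> real" where
  "gram z r s = integral (cbox a b) (\<lambda>x. (c r x - f r) * (c s x - f s) * exp (expo z x))"

definition K :: real where "K = 1 + (\<Sum>k<n. \<bar>f k\<bar>)"

definition vol :: real where "vol = measure lborel (cbox a b)"

lemma K_pos: "1 \<le> K" by (simp add: K_def sum_nonneg)

lemma vol_nonneg: "0 \<le> vol" by (simp add: vol_def)

lemma cont_expo [continuous_intros]: "continuous_on (cbox a b) (expo z)"
  unfolding expo_def by (intro continuous_intros cont) auto

lemma centred_le: "r < n \<Longrightarrow> x \<in> cbox a b \<Longrightarrow> \<bar>c r x - f r\<bar> \<le> K"
proof -
  assume r: "r < n" and x: "x \<in> cbox a b"
  have "\<bar>f r\<bar> \<le> (\<Sum>k<n. \<bar>f k\<bar>)" by (rule member_le_sum) (use r in auto)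
  then show ?thesis using bound [OF r x] unfolding K_def by linarith
qed

lemma expo_diff: "expo z x - expo w x = (\<Sum>k<n. c k x * (z $ k - w $ k))"
  unfolding expo_def sum_subtractf [symmetric] by (intro sum.cong refl) (simp add: algebra_simps)

lemma expo_diff_le: "x \<in> cbox a b \<Longrightarrow> \<bar>expo z x - expo w x\<bar> \<le> d1 n z w"
  unfolding expo_diff using pairing_le [of n "\<lambda>k. c k x" 1] bound by simp

lemma abs_expo_le: "x \<in> cbox a b \<Longrightarrow> \<bar>expo z x\<bar> \<le> l1 n (\<lambda>k. z $ k)"
  unfolding expo_def using pairing_le [of n "\<lambda>k. c k x" 1 "\<lambda>k. z $ k"] bound
  by (simp add: mult.commute)

lemma abs_integral_le:
  assumes "continuous_on (cbox a b) g" "\<And>x. x \<in> cbox a b \<Longrightarrow> \<bar>g x\<bar> \<le> B" "0 \<le> B"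
  shows "\<bar>integral (cbox a b) g\<bar> \<le> B * vol"
  using has_integral_bound [OF assms(3) integrable_integral [OF integrable_continuous [OF assms(1)]]]
    assms(2) by (simp add: vol_def)

lemma weighted_exp_bound:
  assumes "\<bar>g\<bar> \<le> K" "x \<in> cbox a b" "\<bar>h\<bar> \<le> exp (expo w x) * B" "0 \<le> B"
  shows "\<bar>g * h\<bar> \<le> K * exp (l1 n (\<lambda>k. w $ k)) * B"
proof -
  have "expo w x \<le> l1 n (\<lambda>k. w $ k)" using abs_expo_le [OF assms(2), of w] by simp
  then have "exp (expo w x) * B \<le> exp (l1 n (\<lambda>k. w $ k)) * B"
    using assms(4) by (intro mult_right_mono) auto
  then have "\<bar>h\<bar> \<le> exp (l1 n (\<lambda>k. w $ k)) * B" using assms(3) by linarith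
  then show ?thesis
    unfolding abs_mult mult.assoc using assms(1) K_pos by (intro mult_mono) auto
qed

text \<open>
  With \<open>m = w\<close> this is differentiability at \<open>w\<close>, and for small \<open>\<rho>\<close> it is strict differentiability at
  \<open>w\<close>. Both follow from the pointwise inequality \<open>exp_secant_le\<close> for the exponents at \<open>z\<close>, \<open>m\<close> and \<open>w\<close>.
\<close>

lemma moment_expansion:
  assumes r: "r < n" and d: "d1 n z w \<le> \<rho>" "d1 n m w \<le> \<rho>"
  shows "\<bar>moment r z - moment r m - (\<Sum>s<n. moment_deriv r s w * (z $ s - m $ s))\<bar>
    \<le> K * exp (l1 n (\<lambda>k. w $ k)) * ((exp \<rho> - 1) * d1 n z m) * vol"
proof -
  define h where "h x = exp (expo z x) - exp (expo m x) - exp (expo w x) * (expo z x - expo m x)" for x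
  have \<rho>: "0 \<le> \<rho>" using l1_nonneg d(1) by (rule order_trans)
  have ch: "continuous_on (cbox a b) (\<lambda>x. (c r x - f r) * h x)"
    unfolding h_def by (intro continuous_intros cont r)
  have i1: "(\<lambda>x. (c r x - f r) * exp (expo u x)) integrable_on cbox a b" for u
    by (intro integrable_continuous continuous_intros cont r)
  have i2: "(\<lambda>x. (c r x - f r) * c s x * exp (expo w x) * t) integrable_on cbox a b" if "s < n" for s t
    by (intro integrable_continuous continuous_intros cont r that)
  have eq: "(c r x - f r) * h x = ((c r x - f r) * exp (expo z x) - (c r x - f r) * exp (expo m x))
      - (\<Sum>s<n. (c r x - f r) * c s x * exp (expo w x) * (z $ s - m $ s))" for x
  proof -
    have "(c r x - f r) * (exp (expo w x) * (expo z x - expo m x))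
        = (\<Sum>s<n. (c r x - f r) * c s x * exp (expo w x) * (z $ s - m $ s))"
      unfolding expo_diff sum_distrib_left by (intro sum.cong refl) (simp add: mult_ac)
    then show ?thesis by (simp add: h_def right_diff_distrib)
  qed
  have sum_eq: "integral (cbox a b) (\<lambda>x. \<Sum>s<n. (c r x - f r) * c s x * exp (expo w x) * (z $ s - m $ s))
      = (\<Sum>s<n. integral (cbox a b) (\<lambda>x. (c r x - f r) * c s x * exp (expo w x) * (z $ s - m $ s)))"
    by (rule integral_sum) (auto intro: i2)
  have "integral (cbox a b) (\<lambda>x. (c r x - f r) * h x)
      = moment r z - moment r m - (\<Sum>s<n. moment_deriv r s w * (z $ s - m $ s))"
    unfolding eq
    by (subst integral_diff)
      (auto intro!: integrable_diff integrable_sum i1 i2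
        simp: integral_diff [OF i1 i1] sum_eq moment_def moment_deriv_def)
  moreover have "\<bar>integral (cbox a b) (\<lambda>x. (c r x - f r) * h x)\<bar>
      \<le> K * exp (l1 n (\<lambda>k. w $ k)) * ((exp \<rho> - 1) * d1 n z m) * vol"
  proof (rule abs_integral_le [OF ch])
    fix x assume x: "x \<in> cbox a b"
    have "\<bar>h x\<bar> \<le> exp (expo w x) * (exp \<rho> - 1) * \<bar>expo z x - expo m x\<bar>"
      unfolding h_def using expo_diff_le [OF x] d by (intro exp_secant_le) (auto intro: order_trans)
    also have "\<dots> \<le> exp (expo w x) * (exp \<rho> - 1) * d1 n z m"
      using expo_diff_le [OF x] \<rho> by (intro mult_left_mono) auto
    finally show "\<bar>(c r x - f r) * h x\<bar> \<le> K * exp (l1 n (\<lambda>k. w $ k)) * ((exp \<rho> - 1) * d1 n z m)"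
      using \<rho> by (intro weighted_exp_bound [OF _ x] centred_le r x) (auto simp: mult.assoc)
  qed (use \<rho> K_pos in auto)
  ultimately show ?thesis by simp
qed

lemma moment_deriv_diff_le:
  assumes r: "r < n" and s: "s < n" and d: "d1 n z w \<le> \<rho>"
  shows "\<bar>moment_deriv r s z - moment_deriv r s w\<bar>
    \<le> K * exp (l1 n (\<lambda>k. w $ k)) * (exp \<rho> - 1) * vol"
proof -
  have \<rho>: "0 \<le> \<rho>" using l1_nonneg d(1) by (rule order_trans)
  have i: "(\<lambda>x. (c r x - f r) * c s x * exp (expo u x)) integrable_on cbox a b" for u
    by (intro integrable_continuous continuous_intros cont r s)
  have "moment_deriv r s z - moment_deriv r s w
      = integral (cbox a b) (\<lambda>x. ((c r x - f r) * c s x) * (exp (expo z x) - exp (expo w x)))"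
    unfolding moment_deriv_def integral_diff [OF i i, symmetric] by (simp add: right_diff_distrib)
  also have "\<bar>\<dots>\<bar> \<le> K * exp (l1 n (\<lambda>k. w $ k)) * (exp \<rho> - 1) * vol"
  proof (rule abs_integral_le)
    show "continuous_on (cbox a b) (\<lambda>x. ((c r x - f r) * c s x) * (exp (expo z x) - exp (expo w x)))"
      by (intro continuous_intros cont r s)
    fix x assume x: "x \<in> cbox a b"
    have "\<bar>c r x - f r\<bar> * \<bar>c s x\<bar> \<le> K * 1"
      using centred_le [OF r x] bound [OF s x] by (intro mult_mono) auto
    moreover have "\<bar>exp (expo z x) - exp (expo w x)\<bar> \<le> exp (expo w x) * (exp \<rho> - 1)"
    proof -
      have "exp \<bar>expo z x - expo w x\<bar> \<le> exp \<rho>" using expo_diff_le [OF x, of z w] d by simp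
      then have "exp (expo w x) * (exp \<bar>expo z x - expo w x\<bar> - 1) \<le> exp (expo w x) * (exp \<rho> - 1)"
        by simp
      then show ?thesis using abs_exp_diff_le order_trans by blast
    qed
    ultimately show "\<bar>((c r x - f r) * c s x) * (exp (expo z x) - exp (expo w x))\<bar>
        \<le> K * exp (l1 n (\<lambda>k. w $ k)) * (exp \<rho> - 1)"
      using \<rho> by (intro weighted_exp_bound [OF _ x]) (auto simp: abs_mult)
  qed (use \<rho> K_pos in auto)
  finally show ?thesis .
qed

lemma moment_diff_le:
  assumes r: "r < n" and d: "d1 n z w \<le> \<rho>"
  shows "\<bar>moment r z - moment r w\<bar> \<le> K * exp (l1 n (\<lambda>k. w $ k)) * (exp \<rho> - 1) * vol"
proof -
  have \<rho>: "0 \<le> \<rho>" using l1_nonneg d(1) by (rule order_trans)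
  have i: "(\<lambda>x. (c r x - f r) * exp (expo u x)) integrable_on cbox a b" for u
    by (intro integrable_continuous continuous_intros cont r)
  have "moment r z - moment r w
      = integral (cbox a b) (\<lambda>x. (c r x - f r) * (exp (expo z x) - exp (expo w x)))"
    unfolding moment_def integral_diff [OF i i, symmetric] by (simp add: right_diff_distrib)
  also have "\<bar>\<dots>\<bar> \<le> K * exp (l1 n (\<lambda>k. w $ k)) * (exp \<rho> - 1) * vol"
  proof (rule abs_integral_le)
    show "continuous_on (cbox a b) (\<lambda>x. (c r x - f r) * (exp (expo z x) - exp (expo w x)))"
      by (intro continuous_intros cont r)
    fix x assume x: "x \<in> cbox a b"
    have "exp \<bar>expo z x - expo w x\<bar> \<le> exp \<rho>" using expo_diff_le [OF x, of z w] d by simp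
    then have "exp (expo w x) * (exp \<bar>expo z x - expo w x\<bar> - 1) \<le> exp (expo w x) * (exp \<rho> - 1)"
      by simp
    then have "\<bar>exp (expo z x) - exp (expo w x)\<bar> \<le> exp (expo w x) * (exp \<rho> - 1)"
      using abs_exp_diff_le order_trans by blast
    then show "\<bar>(c r x - f r) * (exp (expo z x) - exp (expo w x))\<bar>
        \<le> K * exp (l1 n (\<lambda>k. w $ k)) * (exp \<rho> - 1)"
      using \<rho> by (intro weighted_exp_bound [OF _ x] centred_le r x) auto
  qed (use \<rho> K_pos in auto)
  finally show ?thesis .
qed

lemma moment_has_partial_derivative:
  assumes z: "z \<in> carrier_vec n" and r: "r < n" and s: "s < n"
  shows "((\<lambda>t. moment r (z |\<^sub>v s \<mapsto> t)) has_real_derivative moment_deriv r s z) (at (z $ s))"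
proof -
  define M where "M = K * exp (l1 n (\<lambda>k. z $ k)) * vol"
  have z_id: "z |\<^sub>v s \<mapsto> z $ s = z"
    using z s by (intro eq_vecI) (auto simp: update_vec_def)
  have est: "\<bar>(moment r (z |\<^sub>v s \<mapsto> t) - moment r z) / (t - z $ s) - moment_deriv r s z\<bar>
      \<le> M * (exp \<bar>t - z $ s\<bar> - 1)" if "t \<noteq> z $ s" for t
  proof -
    let ?y = "z |\<^sub>v s \<mapsto> t" and ?h = "t - z $ s"
    have comp: "?y $ j - z $ j = (if j = s then ?h else 0)" if "j < n" for j
      using that z by (simp add: update_vec_def)
    have sum: "(\<Sum>j<n. g j * (?y $ j - z $ j)) = g s * ?h" for g
    proof -
      have "(\<Sum>j<n. g j * (?y $ j - z $ j)) = (\<Sum>j<n. if j = s then g s * ?h else 0)"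
        by (intro sum.cong refl) (simp add: comp)
      then show ?thesis using s by simp
    qed
    have d: "d1 n ?y z = \<bar>?h\<bar>"
    proof -
      have "d1 n ?y z = (\<Sum>j<n. if j = s then \<bar>?h\<bar> else 0)"
        unfolding l1_def by (intro sum.cong refl) (simp add: comp)
      then show ?thesis using s by simp
    qed
    have "d1 n z z \<le> \<bar>?h\<bar>" by (simp add: l1_def)
    then have "\<bar>moment r ?y - moment r z - moment_deriv r s z * ?h\<bar> \<le> M * (exp \<bar>?h\<bar> - 1) * \<bar>?h\<bar>"
      using moment_expansion [OF r, of ?y z "\<bar>?h\<bar>" z] d sum by (simp add: M_def mult_ac)
    moreover have "(moment r ?y - moment r z) / ?h - moment_deriv r s z
        = (moment r ?y - moment r z - moment_deriv r s z * ?h) / ?h"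
      using that by (simp add: diff_divide_distrib)
    ultimately show ?thesis
      using that by (simp add: abs_divide pos_divide_le_eq)
  qed
  have lim: "((\<lambda>t. M * (exp \<bar>t - z $ s\<bar> - 1)) \<longlongrightarrow> 0) (at (z $ s))"
    by (auto intro!: tendsto_eq_intros)
  have "((\<lambda>t. (moment r (z |\<^sub>v s \<mapsto> t) - moment r z) / (t - z $ s) - moment_deriv r s z) \<longlongrightarrow> 0) (at (z $ s))"
    by (rule Lim_null_comparison [OF _ lim]) (use est in \<open>auto simp: eventually_at_filter\<close>)
  then show ?thesis
    unfolding has_field_derivative_iff z_id by (simp add: LIM_zero_iff)
qed

lemma qform_gram:
  "qform (gram z) n v = integral (cbox a b) (\<lambda>x. (\<Sum>r<n. v r * (c r x - f r))\<^sup>2 * exp (expo z x))"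
proof -
  have i: "(\<lambda>x. (c r x - f r) * (c s x - f s) * exp (expo z x) * t) integrable_on cbox a b"
    if "r < n" "s < n" for r s t
    by (intro integrable_continuous continuous_intros cont that)
  have "(\<Sum>r<n. v r * (c r x - f r))\<^sup>2 * exp (expo z x)
      = (\<Sum>r<n. \<Sum>s<n. (c r x - f r) * (c s x - f s) * exp (expo z x) * (v r * v s))" for x
    unfolding power2_eq_square sum_product unfolding sum_distrib_right
    by (intro sum.cong refl) (simp add: mult_ac)
  moreover have "integral (cbox a b) (\<lambda>x. \<Sum>r<n. \<Sum>s<n.
        (c r x - f r) * (c s x - f s) * exp (expo z x) * (v r * v s))
      = (\<Sum>r<n. integral (cbox a b) (\<lambda>x. \<Sum>s<n.
        (c r x - f r) * (c s x - f s) * exp (expo z x) * (v r * v s)))"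
    by (rule integral_sum) (auto intro!: integrable_sum i)
  moreover have "\<dots> = (\<Sum>r<n. \<Sum>s<n. integral (cbox a b) (\<lambda>x.
        (c r x - f r) * (c s x - f s) * exp (expo z x) * (v r * v s)))"
    by (intro sum.cong refl integral_sum) (auto intro: i)
  moreover have "integral (cbox a b) (\<lambda>x.
        (c r x - f r) * (c s x - f s) * exp (expo z x) * (v r * v s)) = gram z r s * v r * v s" for r s
    by (simp only: gram_def Henstock_Kurzweil_Integration.integral_mult_left mult.assoc [of _ "v r"])
  ultimately show ?thesis
    by (simp only: qform_def)
qed

text \<open>
  The form is \<open>\<integral> P\<^sup>2 exp (\<dots>)\<close> with \<open>P = \<Sum>\<^sub>r v\<^sub>r (c\<^sub>r - f\<^sub>r)\<close>. It vanishes only if the continuous function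
  \<open>P\<close> does, and then \<open>v = 0\<close> by independence.
\<close>

lemma gram_coercive: "\<exists>\<kappa>. coercive \<kappa> n (gram z)"
proof (rule pos_def_imp_coercive)
  fix v :: "nat \<Rightarrow> real" and j assume j: "j < n" "v j \<noteq> 0"
  define P where "P x = (\<Sum>r<n. v r * (c r x - f r))" for x
  have cont_P: "continuous_on (cbox a b) (\<lambda>x. (P x)\<^sup>2 * exp (expo z x))"
    unfolding P_def by (intro continuous_intros cont) auto
  have q: "qform (gram z) n v = integral (cbox a b) (\<lambda>x. (P x)\<^sup>2 * exp (expo z x))"
    by (simp add: qform_gram P_def)
  have "qform (gram z) n v \<noteq> 0"
  proof
    assume "qform (gram z) n v = 0"
    then have "((\<lambda>x. (P x)\<^sup>2 * exp (expo z x)) has_integral 0) (cbox a b)"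
      using integrable_integral [OF integrable_continuous [OF cont_P]] q by simp
    then have "(P x)\<^sup>2 * exp (expo z x) = 0" if "x \<in> cbox a b" for x
      by (intro has_integral_0_cbox_imp_0 [OF cont_P _ _ box_ne that]) auto
    then have "P x = 0" if "x \<in> cbox a b" for x using that by simp
    then have "v j = 0" using indep [of v j] j by (simp add: P_def)
    then show False using j by simp
  qed
  moreover have "0 \<le> qform (gram z) n v"
    unfolding q by (rule integral_nonneg [OF integrable_continuous [OF cont_P]]) simp
  ultimately show "0 < qform (gram z) n v" by simp
qed

text \<open>
  Replacing \<open>c\<^sub>s\<close> by \<open>c\<^sub>s - f\<^sub>s\<close> in the integral for \<open>\<partial>F\<^sub>r/\<partial>\<lambda>\<^sub>s\<close> changes it by \<open>f\<^sub>s F\<^sub>r\<close>, which vanishes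
  at a zero. This is the reason why the Jacobian is symmetric there, although it is not in general.
\<close>

lemma moment_deriv_eq_gram:
  assumes "r < n" "s < n" "moment r z = 0"
  shows "moment_deriv r s z = gram z r s"
proof -
  have "moment_deriv r s z = gram z r s + f s * moment r z"
    unfolding moment_deriv_def gram_def moment_def integral_mult_right [symmetric]
    by (subst integral_add [symmetric])
      (auto intro!: integral_cong integrable_continuous continuous_intros cont assms(1,2)
        simp: algebra_simps)
  then show ?thesis using assms(3) by simp
qed

lemma small_exp_bound:
  fixes M \<eta> :: real
  assumes "0 \<le> M" "0 < \<eta>"
  obtains \<rho> where "0 < \<rho>" "M * (exp \<rho> - 1) \<le> \<eta>"
proof
  have pos: "0 < \<eta> / (M + 1)" using assms by simp
  show "0 < ln (1 + \<eta> / (M + 1))" using pos by simp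
  have "M * (\<eta> / (M + 1)) \<le> (M + 1) * (\<eta> / (M + 1))"
    using pos by (intro mult_right_mono) auto
  moreover have "exp (ln (1 + \<eta> / (M + 1))) = 1 + \<eta> / (M + 1)"
    by (rule exp_ln) (use pos in linarith)
  ultimately show "M * (exp (ln (1 + \<eta> / (M + 1))) - 1) \<le> \<eta>" using assms by simp
qed

lemma spd_zero_moment:
  assumes zero: "\<And>r. r < n \<Longrightarrow> moment r x0 = 0"
  shows "spd_zero n moment moment_deriv x0"
proof
  define M where "M = K * exp (l1 n (\<lambda>k. x0 $ k)) * vol"
  have M: "0 \<le> M" using K_pos vol_nonneg by (simp add: M_def)
  show "((\<lambda>t. moment r (z |\<^sub>v s \<mapsto> t)) has_real_derivative moment_deriv r s z) (at (z $ s))"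
    if "z \<in> carrier_vec n" "r < n" "s < n" for z r s
    using moment_has_partial_derivative that by blast
  fix \<eta> :: real assume \<eta>: "0 < \<eta>"
  obtain \<rho> where \<rho>: "0 < \<rho>" "M * (exp \<rho> - 1) \<le> \<eta>" using small_exp_bound [OF M \<eta>] by blast
  have "\<bar>moment r z - moment r m - (\<Sum>s<n. moment_deriv r s x0 * (z $ s - m $ s))\<bar> \<le> \<eta> * d1 n z m"
    if "r < n" "d1 n z x0 < \<rho>" "d1 n m x0 < \<rho>" for r z m
  proof -
    have "M * (exp \<rho> - 1) * d1 n z m \<le> \<eta> * d1 n z m" by (rule mult_right_mono [OF \<rho>(2)]) simp
    then show ?thesis using moment_expansion [of r z x0 \<rho> m] that by (simp add: M_def mult_ac)
  qed
  then show "\<exists>\<rho>>0. \<forall>z\<in>carrier_vec n. \<forall>m\<in>carrier_vec n. \<forall>r<n. d1 n z x0 < \<rho> \<longrightarrow> d1 n m x0 < \<rho> \<longrightarrow>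
      \<bar>moment r z - moment r m - (\<Sum>s<n. moment_deriv r s x0 * (z $ s - m $ s))\<bar> \<le> \<eta> * d1 n z m"
    using \<rho>(1) by blast
  have "\<bar>moment_deriv r s z - moment_deriv r s x0\<bar> \<le> \<eta>"
    if "r < n" "s < n" "d1 n z x0 < \<rho>" for r s z
    using moment_deriv_diff_le [of r s z x0 \<rho>] that \<rho>(2) by (simp add: M_def mult_ac)
  then show "\<exists>\<rho>>0. \<forall>z\<in>carrier_vec n. \<forall>r<n. \<forall>s<n. d1 n z x0 < \<rho> \<longrightarrow>
      \<bar>moment_deriv r s z - moment_deriv r s x0\<bar> \<le> \<eta>"
    using \<rho>(1) by blast
next
  show "moment_deriv r s x0 = moment_deriv s r x0" if "r < n" "s < n" for r s
    using that zero by (simp add: moment_deriv_eq_gram gram_def mult_ac)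
  have "qform (\<lambda>r s. moment_deriv r s x0) n v = qform (gram x0) n v" for v
    unfolding qform_def by (intro sum.cong refl) (simp add: moment_deriv_eq_gram zero)
  then show "\<exists>\<kappa>. coercive \<kappa> n (\<lambda>r s. moment_deriv r s x0)"
    using gram_coercive [of x0] by (simp add: coercive_def)
qed

text \<open>
  With \<open>P = \<Sum>\<^sub>j (m\<^sub>j - w\<^sub>j) (c\<^sub>j - f\<^sub>j)\<close>, the exponent at \<open>m\<close> is the exponent at \<open>w\<close> plus \<open>P\<close> plus a constant.
  The hypothesis therefore says that \<open>\<integral> P exp (expo w + P) = 0\<close>, and subtracting it from the
  right-hand side gives \<open>\<integral> exp (expo w) P (exp P - 1)\<close>. By \<open>mult_exp_minus_one_ge\<close> this is at least a
  multiple of \<open>\<integral> P\<^sup>2\<close>, that is, of the quadratic form of the Gram matrix at 0.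
\<close>

lemma moment_monotone:
  assumes S: "coercive \<kappa> n (gram (0\<^sub>v n))"
    and z: "(\<Sum>j<n. (m $ j - w $ j) * moment j m) = 0"
  shows "exp (- l1 n (\<lambda>k. w $ k)) * (\<kappa> * (d1 n m w)\<^sup>2) / (1 + K * d1 n m w)
    \<le> - (\<Sum>j<n. (m $ j - w $ j) * moment j w)"
proof -
  define v where "v j = m $ j - w $ j" for j
  define P where "P x = (\<Sum>j<n. v j * (c j x - f j))" for x
  define \<phi> where "\<phi> = (\<Sum>j<n. v j * f j)"
  define E where "E = exp (- l1 n (\<lambda>k. w $ k)) / (1 + K * d1 n m w)"
  have V: "l1 n v = d1 n m w" by (simp add: v_def l1_def)
  have cP [continuous_intros]: "continuous_on (cbox a b) P"
    unfolding P_def by (intro continuous_intros cont) auto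
  have em: "expo m x = expo w x + P x + \<phi>" for x
    using expo_diff [of m x w] unfolding P_def \<phi>_def v_def
    by (simp add: algebra_simps sum.distrib sum_subtractf)
  have int: "(\<Sum>j<n. v j * moment j u) = integral (cbox a b) (\<lambda>x. P x * exp (expo u x))" for u
  proof -
    have i: "(\<lambda>x. v j * ((c j x - f j) * exp (expo u x))) integrable_on cbox a b" if "j < n" for j
      by (intro integrable_continuous continuous_intros cont that)
    have "P x * exp (expo u x) = (\<Sum>j<n. v j * ((c j x - f j) * exp (expo u x)))" for x
      by (simp add: P_def sum_distrib_right mult.assoc)
    moreover have "integral (cbox a b) (\<lambda>x. \<Sum>j<n. v j * ((c j x - f j) * exp (expo u x)))
        = (\<Sum>j<n. integral (cbox a b) (\<lambda>x. v j * ((c j x - f j) * exp (expo u x))))"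
      by (rule integral_sum) (auto intro: i)
    ultimately show ?thesis by (simp add: moment_def)
  qed
  have ci: "(\<lambda>x. P x * exp (expo u x)) integrable_on cbox a b" for u
    by (intro integrable_continuous continuous_intros)
  have 0: "integral (cbox a b) (\<lambda>x. P x * exp (expo w x + P x)) = 0"
  proof -
    have "(\<lambda>x. P x * exp (expo w x + P x)) = (\<lambda>x. exp (- \<phi>) * (P x * exp (expo m x)))"
      by (simp add: em exp_add exp_minus fun_eq_iff)
    then have "integral (cbox a b) (\<lambda>x. P x * exp (expo w x + P x))
        = exp (- \<phi>) * integral (cbox a b) (\<lambda>x. P x * exp (expo m x))" by simp
    also have "\<dots> = 0" using z int [of m] by (simp add: v_def)
    finally show ?thesis .
  qed
  have i0: "(\<lambda>x. P x * exp (expo w x + P x)) integrable_on cbox a b"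
    by (intro integrable_continuous continuous_intros)
  have "E * (\<kappa> * (d1 n m w)\<^sup>2) \<le> E * qform (gram (0\<^sub>v n)) n v"
    using S K_pos by (intro mult_left_mono) (auto simp: coercive_def E_def V [symmetric] add_nonneg_nonneg)
  also have "\<dots> = integral (cbox a b) (\<lambda>x. E * (P x)\<^sup>2)"
    by (simp add: qform_gram P_def expo_def)
  also have "\<dots> \<le> integral (cbox a b) (\<lambda>x. P x * exp (expo w x + P x) - P x * exp (expo w x))"
  proof (rule integral_le)
    show "(\<lambda>x. E * (P x)\<^sup>2) integrable_on cbox a b"
      by (intro integrable_continuous continuous_intros)
    show "(\<lambda>x. P x * exp (expo w x + P x) - P x * exp (expo w x)) integrable_on cbox a b"
      by (intro integrable_continuous continuous_intros)
    fix x assume x: "x \<in> cbox a b"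
    have "\<bar>P x\<bar> \<le> K * d1 n m w"
      unfolding P_def using pairing_le [of n "\<lambda>j. c j x - f j" K v] centred_le x V
      by (simp add: mult.commute)
    then have "(P x)\<^sup>2 / (1 + K * d1 n m w) \<le> (P x)\<^sup>2 / (1 + \<bar>P x\<bar>)"
      by (intro divide_left_mono) (auto intro!: mult_pos_pos add_pos_nonneg)
    also have "\<dots> \<le> P x * (exp (P x) - 1)" by (rule mult_exp_minus_one_ge)
    finally have 1: "(P x)\<^sup>2 / (1 + K * d1 n m w) \<le> P x * (exp (P x) - 1)" .
    have "- l1 n (\<lambda>k. w $ k) \<le> expo w x" using abs_expo_le [OF x, of w] by linarith
    then have "exp (- l1 n (\<lambda>k. w $ k)) * ((P x)\<^sup>2 / (1 + K * d1 n m w))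
        \<le> exp (expo w x) * (P x * (exp (P x) - 1))"
      using 1 K_pos by (intro mult_mono) auto
    then show "E * (P x)\<^sup>2 \<le> P x * exp (expo w x + P x) - P x * exp (expo w x)"
      by (simp add: E_def exp_add algebra_simps)
  qed
  also have "\<dots> = - (\<Sum>j<n. v j * moment j w)"
    by (simp add: integral_diff [OF i0 ci] 0 int)
  finally show ?thesis by (simp add: E_def v_def)
qed

text \<open>
  Compare the zero, padded by \<open>\<alpha>\<close>, with the point \<open>w\<close> that has the same frozen components and agrees
  with \<open>x\<^sub>0\<close> in the first \<open>i\<close> ones. The difference \<open>V\<close> involves only components whose equations hold at
  the zero, so \<open>moment_monotone\<close> applies. The moments at \<open>w\<close> are at most \<open>\<eta>\<close>, as \<open>w\<close> is close to \<open>x\<^sub>0\<close>;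
  hence \<open>\<kappa>' V\<^sup>2 / (1 + K V) \<le> \<eta> V\<close>, which for small \<open>\<eta>\<close> forces \<open>V \<le> 2 \<eta> / \<kappa>'\<close>.
\<close>

lemma frozen_zero_near:
  assumes x0: "x0 \<in> carrier_vec n" and zero: "\<And>r. r < n \<Longrightarrow> moment r x0 = 0" and "0 < \<epsilon>"
  obtains \<delta> where "0 < \<delta>"
    "\<And>\<alpha> i m. \<lbrakk>\<alpha> \<in> carrier_vec n; d1 n \<alpha> x0 < \<delta>; i \<le> n; m \<in> carrier_vec i;
        \<And>r. r < i \<Longrightarrow> frozen \<alpha> moment r m = 0\<rbrakk> \<Longrightarrow> d1 n (pad \<alpha> m) x0 < \<epsilon>"
proof -
  obtain \<kappa> where S: "coercive \<kappa> n (gram (0\<^sub>v n))" using gram_coercive by blast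
  then have \<kappa>: "0 < \<kappa>" by (simp add: coercive_def)
  define \<kappa>' where "\<kappa>' = exp (- l1 n (\<lambda>k. x0 $ k) - 1) * \<kappa>"
  have \<kappa>': "0 < \<kappa>'" using \<kappa> by (simp add: \<kappa>'_def)
  define M where "M = K * exp (l1 n (\<lambda>k. x0 $ k)) * vol"
  have M: "0 \<le> M" using K_pos vol_nonneg by (simp add: M_def)
  define \<eta> where "\<eta> = min (\<kappa>' / (2 * K)) (\<kappa>' * \<epsilon> / 4)"
  have \<eta>: "0 < \<eta>" "\<eta> * K \<le> \<kappa>' / 2" "2 * \<eta> / \<kappa>' \<le> \<epsilon> / 2"
  proof -
    show "0 < \<eta>" using \<kappa>' K_pos \<open>0 < \<epsilon>\<close> by (simp add: \<eta>_def)
    have "\<eta> \<le> \<kappa>' / (2 * K)" "\<eta> \<le> \<kappa>' * \<epsilon> / 4" by (simp_all add: \<eta>_def)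
    then show "\<eta> * K \<le> \<kappa>' / 2" "2 * \<eta> / \<kappa>' \<le> \<epsilon> / 2"
      using \<kappa>' K_pos by (simp_all add: field_simps)
  qed
  obtain \<rho> where \<rho>: "0 < \<rho>" "M * (exp \<rho> - 1) \<le> \<eta>" using small_exp_bound [OF M \<eta>(1)] by blast
  define \<delta> where "\<delta> = min \<rho> (min 1 (\<epsilon> / 2))"
  have \<delta>: "0 < \<delta>" "\<delta> \<le> \<rho>" "\<delta> \<le> 1" "\<delta> \<le> \<epsilon> / 2" using \<rho> \<open>0 < \<epsilon>\<close> by (auto simp: \<delta>_def)
  show thesis
  proof (rule that [OF \<delta>(1)])
    fix \<alpha> i m
    assume \<alpha>: "\<alpha> \<in> carrier_vec n" and d: "d1 n \<alpha> x0 < \<delta>" and i: "i \<le> n" and m: "m \<in> carrier_vec i"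
      and z: "\<And>r. r < i \<Longrightarrow> frozen \<alpha> moment r m = 0"
    define p where "p = pad \<alpha> m"
    define w where "w = Matrix.vec n (\<lambda>j. if j < i then x0 $ j else \<alpha> $ j)"
    define V where "V = d1 n p w"
    have V0: "0 \<le> V" by (simp add: V_def)
    have dw: "d1 n w x0 < \<delta>"
    proof -
      have "d1 n w x0 \<le> d1 n \<alpha> x0" by (rule l1_mono) (simp add: w_def)
      then show ?thesis using d by simp
    qed
    have tail: "p $ j - w $ j = 0" if "i \<le> j" "j < n" for j
      using that \<alpha> m by (simp add: p_def w_def pad_def)
    have "(\<Sum>j<n. (p $ j - w $ j) * moment j p) = 0"
    proof (rule sum.neutral, rule ballI)
      fix j assume "j \<in> {..<n}"
      then show "(p $ j - w $ j) * moment j p = 0"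
        using tail [of j] z [of j] by (cases "j < i") (simp_all add: p_def frozen_pad)
    qed
    then have mono: "exp (- l1 n (\<lambda>k. w $ k)) * (\<kappa> * V\<^sup>2) / (1 + K * V)
        \<le> - (\<Sum>j<n. (p $ j - w $ j) * moment j w)"
      unfolding V_def by (rule moment_monotone [OF S])
    have "\<bar>moment j w\<bar> \<le> \<eta>" if "j < n" for j
      using moment_diff_le [of j w x0 \<rho>] zero [OF that] that dw \<delta>(2) \<rho>(2) by (simp add: M_def mult_ac)
    then have "\<bar>\<Sum>j<n. moment j w * (p $ j - w $ j)\<bar> \<le> \<eta> * V"
      unfolding V_def by (rule pairing_le)
    then have up: "exp (- l1 n (\<lambda>k. w $ k)) * (\<kappa> * V\<^sup>2) / (1 + K * V) \<le> \<eta> * V"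
      using mono by (simp add: mult.commute)
    have "l1 n (\<lambda>k. w $ k) \<le> l1 n (\<lambda>k. x0 $ k) + 1"
      using l1_triangle [of n "\<lambda>k. w $ k" "\<lambda>k. 0" "\<lambda>k. x0 $ k"] dw \<delta>(3) by simp
    then have "\<kappa>' * V\<^sup>2 \<le> exp (- l1 n (\<lambda>k. w $ k)) * (\<kappa> * V\<^sup>2)"
      unfolding \<kappa>'_def mult.assoc using \<kappa> by (intro mult_right_mono) auto
    then have "\<kappa>' * V\<^sup>2 / (1 + K * V) \<le> exp (- l1 n (\<lambda>k. w $ k)) * (\<kappa> * V\<^sup>2) / (1 + K * V)"
      using K_pos V0 by (intro divide_right_mono) auto
    with up have "\<kappa>' * V\<^sup>2 / (1 + K * V) \<le> \<eta> * V" by linarith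
    moreover have "0 < 1 + K * V" using K_pos V0 by (simp add: add_pos_nonneg)
    ultimately have "\<kappa>' * V\<^sup>2 \<le> \<eta> * V * (1 + K * V)" by (simp add: pos_divide_le_eq)
    then have "(\<kappa>' * V) * V \<le> (\<eta> * (1 + K * V)) * V" by (simp add: power2_eq_square mult_ac)
    then have "V = 0 \<or> \<kappa>' * V \<le> \<eta> + (\<eta> * K) * V"
      using V0 mult_le_cancel_right_pos [of V "\<kappa>' * V" "\<eta> * (1 + K * V)"]
      by (auto simp: distrib_left mult.assoc less_le)
    moreover have "(\<eta> * K) * V \<le> \<kappa>' / 2 * V" using \<eta>(2) V0 by (rule mult_right_mono)
    ultimately have "V = 0 \<or> \<kappa>' / 2 * V \<le> \<eta>" by (auto simp: field_simps)
    then have "V \<le> 2 * \<eta> / \<kappa>'" using \<kappa>' \<eta>(1) by (auto simp: field_simps)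
    then have "V \<le> \<epsilon> / 2" using \<eta>(3) by linarith
    then show "d1 n (pad \<alpha> m) x0 < \<epsilon>"
      using l1_triangle [of n "\<lambda>k. p $ k" "\<lambda>k. x0 $ k" "\<lambda>k. w $ k"] dw \<delta>(4)
      by (simp add: V_def p_def)
  qed
qed

end

section \<open>Linear independence of monomials\<close>

text \<open>
  Kronecker substitution: with weights \<open>1, N, N\<^sup>2, \<dots>\<close> the weighted sum reads a multi-index with
  entries below \<open>N\<close> as the digits of a number in base \<open>N\<close>.
\<close>

lemma kronecker_weights:
  assumes "finite A"
  shows "\<exists>w :: 'd \<Rightarrow> nat. \<forall>i j. (\<forall>k\<in>A. i k < N \<and> j k < N) \<longrightarrow>
    (\<Sum>k\<in>A. i k * w k) = (\<Sum>k\<in>A. j k * w k) \<longrightarrow> (\<forall>k\<in>A. i k = j k)"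
  using assms
proof induction
  case (insert a A)
  then obtain w where w: "\<And>i j. (\<forall>k\<in>A. i k < N \<and> j k < N) \<Longrightarrow>
    (\<Sum>k\<in>A. i k * w k) = (\<Sum>k\<in>A. j k * w k) \<Longrightarrow> \<forall>k\<in>A. i k = j k" by blast
  define w' where "w' k = (if k = a then 1 else N * w k)" for k
  have sum: "(\<Sum>k\<in>insert a A. i k * w' k) = i a + N * (\<Sum>k\<in>A. i k * w k)" for i
  proof -
    have "(\<Sum>k\<in>A. i k * w' k) = (\<Sum>k\<in>A. N * (i k * w k))"
      using insert.hyps by (intro sum.cong refl) (auto simp: w'_def)
    then show ?thesis using insert.hyps by (simp add: w'_def sum_distrib_left)
  qed
  have *: "\<forall>k\<in>insert a A. i k = j k"
    if b: "\<forall>k\<in>insert a A. i k < N \<and> j k < N"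
      and eq: "(\<Sum>k\<in>insert a A. i k * w' k) = (\<Sum>k\<in>insert a A. j k * w' k)" for i j
  proof -
    have e: "i a + N * (\<Sum>k\<in>A. i k * w k) = j a + N * (\<Sum>k\<in>A. j k * w k)"
      using eq unfolding sum .
    have N: "i a < N" "j a < N" using b by auto
    have "i a = j a" using arg_cong [OF e, of "\<lambda>t. t mod N"] N by simp
    have "(\<Sum>k\<in>A. i k * w k) = (\<Sum>k\<in>A. j k * w k)"
      using e \<open>i a = j a\<close> N(1) by simp
    then have "\<forall>k\<in>A. i k = j k" by (rule w [rotated]) (use b in blast)
    then show ?thesis using \<open>i a = j a\<close> by blast
  qed
  show ?case by (intro exI [of _ w'] allI impI) (rule *)
qed simp

text \<open>
  Along the curve \<open>x\<^sub>j = t ^ w\<^sub>j\<close> with Kronecker weights \<open>w\<close>, distinct monomials become distinct powers of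
  \<open>t\<close>. A linear combination that vanishes on the cube thus yields a univariate polynomial that vanishes
  on \<open>[0, 1]\<close> and has the same coefficients.
\<close>

lemma monomials_independent:
  fixes e :: "'i \<Rightarrow> 'd::finite \<Rightarrow> nat"
  assumes I: "finite I" and inj: "inj_on e I"
    and zero: "\<And>x. x \<in> cbox (-1) 1 \<Longrightarrow> (\<Sum>k\<in>I. u k * monomial (e k) x) = 0"
    and k: "k \<in> I"
  shows "u k = 0"
proof -
  define N where "N = Suc (\<Sum>k\<in>I. \<Sum>j\<in>UNIV. e k j)"
  have N: "e k j < N" if "k \<in> I" for k j
  proof -
    have "e k j \<le> (\<Sum>j\<in>UNIV. e k j)" by (rule member_le_sum) auto
    also have "\<dots> \<le> (\<Sum>k\<in>I. \<Sum>j\<in>UNIV. e k j)"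
      by (rule member_le_sum [of k I "\<lambda>k. \<Sum>j\<in>UNIV. e k j"]) (use that I in auto)
    finally show ?thesis by (simp add: N_def)
  qed
  from kronecker_weights [OF finite [of "UNIV :: 'd set"], of N]
  obtain w :: "'d \<Rightarrow> nat" where w: "\<forall>i j. (\<forall>k\<in>UNIV. i k < N \<and> j k < N) \<longrightarrow>
    (\<Sum>k\<in>UNIV. i k * w k) = (\<Sum>k\<in>UNIV. j k * w k) \<longrightarrow> (\<forall>k\<in>UNIV. i k = j k)" ..
  define W where "W k = (\<Sum>j\<in>UNIV. e k j * w j)" for k
  have W: "W k = W l \<longleftrightarrow> k = l" if "k \<in> I" "l \<in> I" for k l
  proof
    assume "W k = W l"
    moreover have "\<forall>j\<in>UNIV. e k j < N \<and> e l j < N" using N that by blast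
    ultimately have "\<forall>j\<in>UNIV. e k j = e l j"
      unfolding W_def by (rule w [THEN spec, THEN spec, THEN mp, THEN mp, rotated])
    then have "e k = e l" by blast
    then show "k = l" using inj that by (auto dest: inj_onD)
  qed simp
  define P where "P = (\<Sum>k\<in>I. Polynomial.monom (u k) (W k))"
  have "poly P t = 0" if t: "t \<in> {0..1}" for t :: real
  proof -
    define x :: "real ^ 'd" where "x = vec_lambda (\<lambda>j. t ^ w j)"
    have xj: "vec_nth x j = t ^ w j" for j by (simp add: x_def)
    have "x \<in> cbox (-1) 1"
    proof -
      have "0 \<le> t ^ w j \<and> t ^ w j \<le> 1" for j using t by (simp add: power_le_one)
      then show ?thesis by (auto simp: mem_box_cart xj intro: order_trans [of _ 0])
    qed
    moreover have "monomial (e k) x = t ^ W k" for k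
      by (simp add: monomial_def xj W_def power_sum mult.commute flip: power_mult)
    ultimately show ?thesis
      using zero [of x] by (simp add: P_def poly_sum poly_monom)
  qed
  then have "{0..1} \<subseteq> {t. poly P t = 0}" by blast
  moreover have "infinite {0..1::real}" by (rule infinite_Icc) simp
  ultimately have "P = 0" using poly_roots_finite [of P] finite_subset by blast
  then have "0 = coeff P (W k)" by simp
  also have "\<dots> = (\<Sum>l\<in>I. if l = k then u l else 0)"
    unfolding P_def coeff_sum using W k by (intro sum.cong refl) auto
  also have "\<dots> = u k" using I k by simp
  finally show ?thesis by simp
qed

lemma cont_monomial: "continuous_on S (monomial j)"
  unfolding monomial_def by (intro continuous_intros)

lemma abs_monomial_le:
  assumes "x \<in> cbox (-1) 1"
  shows "\<bar>monomial j x\<bar> \<le> 1"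
proof -
  have "\<bar>vec_nth x k\<bar> \<le> 1" for k
    using assms by (auto simp: mem_box_cart abs_le_iff minus_le_iff)
  then show ?thesis
    unfolding monomial_def abs_prod power_abs by (intro prod_le_1) (simp add: power_le_one)
qed

lemma exp_family_monomials:
  fixes e :: "nat \<Rightarrow> 'd::finite \<Rightarrow> nat"
  assumes inj: "inj_on e {..<n}" and deg: "\<And>k. k < n \<Longrightarrow> 1 \<le> sum (e k) UNIV"
  shows "exp_family n (-1) (1 :: real ^ 'd) (\<lambda>k. monomial (e k)) f"
proof
  show "continuous_on (cbox (-1) 1) (monomial (e k))" for k by (rule cont_monomial)
  show "\<bar>monomial (e k) x\<bar> \<le> 1" if "x \<in> cbox (-1) 1" for k x by (rule abs_monomial_le [OF that])
  show "box (-1) (1 :: real ^ 'd) \<noteq> {}" by (simp add: interval_ne_empty_cart)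
  fix v :: "nat \<Rightarrow> real" and k
  assume z: "\<And>x. x \<in> cbox (-1) 1 \<Longrightarrow> (\<Sum>k<n. v k * (monomial (e k) x - f k)) = 0" and k: "k < n"
  \<comment> \<open>The constants \<open>f k\<close> are multiples of the monomial of degree 0, which is adjoined at index \<open>n\<close>.\<close>
  define e' where "e' = e(n := \<lambda>_. 0)"
  define u where "u = v(n := - (\<Sum>k<n. v k * f k))"
  have "e i \<noteq> (\<lambda>_. 0)" if "i < n" for i using deg [OF that] by auto
  then have "inj_on e' {..n}"
    using inj by (fastforce simp: inj_on_def e'_def le_less)
  moreover have "(\<Sum>k\<le>n. u k * monomial (e' k) x) = 0" if x: "x \<in> cbox (-1) 1" for x
  proof -
    have "(\<Sum>k\<le>n. u k * monomial (e' k) x)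
        = (\<Sum>k<n. u k * monomial (e' k) x) + u n * monomial (e' n) x"
      by (simp flip: lessThan_Suc_atMost)
    also have "(\<Sum>k<n. u k * monomial (e' k) x) = (\<Sum>k<n. v k * monomial (e k) x)"
      by (intro sum.cong refl) (simp add: u_def e'_def)
    also have "u n * monomial (e' n) x = - (\<Sum>k<n. v k * f k)"
      by (simp add: u_def e'_def monomial_def)
    finally show ?thesis using z [OF x] by (simp add: right_diff_distrib sum_subtractf)
  qed
  ultimately have "u k = 0"
    using k monomials_independent [of "{..n}" e' u k] by simp
  then show "v k = 0" using k by (simp add: u_def)
qed

section \<open>Convergence of the EBE method\<close>

text \<open>
  The starting point \<open>(\<mu>\<^sup>(\<^sup>k\<^sup>), \<alpha>\<^sub>k\<^sub>+\<^sub>1)\<close> of a step represents the same point of the full space as the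
  limit \<open>\<mu>\<^sup>(\<^sup>k\<^sup>)\<close> of the step before.
\<close>

lemma pad_snoc:
  assumes "\<alpha> \<in> carrier_vec n" "k < n" "v \<in> carrier_vec k"
  shows "pad \<alpha> (snoc_vec v (\<alpha> $ k)) = pad \<alpha> v"
proof (rule eq_vecI)
  have s: "dim_vec (snoc_vec v (\<alpha> $ k)) = Suc k"
    using snoc_vec_carrier [OF assms(3)] by (rule carrier_vecD)
  fix j assume "j < dim_vec (pad \<alpha> v)"
  then have "j < dim_vec \<alpha>" by (simp add: pad_def)
  moreover have "j < k \<or> j = k \<or> \<not> j < Suc k" by linarith
  ultimately show "pad \<alpha> (snoc_vec v (\<alpha> $ k)) $ j = pad \<alpha> v $ j"
    using carrier_vecD [OF assms(3)] s snoc_vec_index(1) [OF assms(3), of j "\<alpha> $ k"]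
      snoc_vec_index(2) [OF assms(3), of "\<alpha> $ k"] by (auto simp: pad_def)
qed (simp add: pad_def)

theorem theorem4p3:
  fixes p n :: nat
    and e :: "nat \<Rightarrow> 'd::finite \<Rightarrow> nat"
    and f :: "nat \<Rightarrow> real"
    and \<mu>n :: "real Matrix.vec"
  assumes "p \<ge> 1"
    and "bij_betw e {..<n} {j. 1 \<le> sum j UNIV \<and> sum j UNIV \<le> p}"
    and "\<mu>n \<in> carrier_vec n"
    and "sys (moment_fun n e f) n \<mu>n = 0\<^sub>v n"
  shows "\<exists>\<delta>>0. \<forall>\<alpha> \<in> carrier_vec n. vdist n \<alpha> \<mu>n < \<delta> \<longrightarrow>
           (\<forall>\<mu>. \<mu> n = \<mu>n \<and> hypothesis_A n (moment_fun n e f) \<alpha> \<mu> \<longrightarrow>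
              (\<forall>i\<in>{1..n}. ebe_limit (moment_fun n e f) \<alpha> i (\<mu> i)) \<and>
              ebe_limit (moment_fun n e f) \<alpha> n \<mu>n)"
proof -
  let ?F = "moment_fun n e f"
  have inj: "inj_on e {..<n}" and deg: "\<And>k. k < n \<Longrightarrow> 1 \<le> sum (e k) UNIV"
    using bij_betw_imp_inj_on [OF assms(2)] bij_betwE [OF assms(2)] by simp_all
  have n: "0 < n"
  proof (rule ccontr)
    assume "\<not> 0 < n"
    then have "{j :: 'd \<Rightarrow> nat. 1 \<le> sum j UNIV \<and> sum j UNIV \<le> p} = {}"
      using assms(2) by (simp add: bij_betw_def)
    moreover have "(\<lambda>k. if k = undefined then 1 else 0) \<in> {j :: 'd \<Rightarrow> nat. 1 \<le> sum j UNIV \<and> sum j UNIV \<le> p}"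
      using assms(1) by simp
    ultimately show False by blast
  qed
  interpret E: exp_family n "-1" "1 :: real ^ 'd" "\<lambda>k. monomial (e k)" f
    by (rule exp_family_monomials [OF inj deg])
  have dom: "{x :: real ^ 'd. \<forall>k. vec_nth x k \<in> {-1..1}} = cbox (-1) 1"
    by (auto simp: mem_box_cart)
  have F: "?F = E.moment"
    by (intro ext) (simp only: moment_fun_def E.moment_def E.expo_def dom)
  have zero: "E.moment r \<mu>n = 0" if "r < n" for r
    using arg_cong [OF assms(4), of "\<lambda>v. v $ r"] that by (simp add: sys_def F)
  interpret Z: spd_zero n E.moment E.moment_deriv \<mu>n
    by (rule E.spd_zero_moment [OF zero])
  \<comment> \<open>The radius \<open>\<rho>\<close> works for step \<open>k + 1\<close>; the smallest radius over all \<open>k\<close> then works for every step.\<close>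
  define good where "good k \<rho> \<longleftrightarrow> (\<forall>\<alpha> m s. \<alpha> \<in> carrier_vec n \<longrightarrow> m \<in> carrier_vec (Suc k) \<longrightarrow>
      s \<in> carrier_vec (Suc k) \<longrightarrow> d1 n (pad \<alpha> m) \<mu>n < \<rho> \<longrightarrow> d1 (Suc k) s m < \<rho> \<longrightarrow>
      (\<forall>r\<le>k. frozen \<alpha> ?F r m = 0) \<longrightarrow> ebe_step_converges (frozen \<alpha> ?F) (Suc k) s m)" for k \<rho>
  have "\<exists>\<rho>>0. good k \<rho>" if "k < n" for k
    using that unfolding F good_def
  proof (rule Z.ebe_step_converges_locally, goal_cases)
    case (1 \<rho>)
    show ?case by (intro exI [of _ \<rho>] conjI allI impI 1) auto
  qed
  then have "\<forall>k\<in>{..<n}. \<exists>\<rho>. 0 < \<rho> \<and> good k \<rho>" by simp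
  then obtain \<rho> where good: "\<forall>k\<in>{..<n}. 0 < \<rho> k \<and> good k (\<rho> k)" by (rule bchoice [THEN exE])
  then have \<rho>: "0 < \<rho> k" if "k < n" for k using that by simp
  have step: "ebe_step_converges (frozen \<alpha> ?F) (Suc k) s m"
    if "k < n" "\<alpha> \<in> carrier_vec n" "m \<in> carrier_vec (Suc k)" "s \<in> carrier_vec (Suc k)"
      "d1 n (pad \<alpha> m) \<mu>n < \<rho> k" "d1 (Suc k) s m < \<rho> k" "\<forall>r\<le>k. frozen \<alpha> ?F r m = 0" for k \<alpha> m s
  proof -
    have "good k (\<rho> k)" using good that(1) by simp
    then show ?thesis using that(2-) unfolding good_def by blast
  qed
  define \<epsilon> where "\<epsilon> = Min (\<rho> ` {..<n})"
  have \<epsilon>: "0 < \<epsilon>" "\<And>k. k < n \<Longrightarrow> \<epsilon> \<le> \<rho> k"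
    unfolding \<epsilon>_def using \<rho> n by (subst Min_gr_iff, auto)
  obtain \<delta> where \<delta>: "0 < \<delta>" and near: "\<And>\<alpha> i m. \<lbrakk>\<alpha> \<in> carrier_vec n; d1 n \<alpha> \<mu>n < \<delta>; i \<le> n;
      m \<in> carrier_vec i; \<And>r. r < i \<Longrightarrow> frozen \<alpha> ?F r m = 0\<rbrakk> \<Longrightarrow> d1 n (pad \<alpha> m) \<mu>n < \<epsilon> / 2"
  proof -
    have "0 < \<epsilon> / 2" using \<epsilon>(1) by simp
    show thesis
    proof (rule E.frozen_zero_near [OF assms(3) _ \<open>0 < \<epsilon> / 2\<close>], erule zero, goal_cases)
      case (1 \<delta>)
      show thesis by (rule that; fact 1 [folded F])
    qed
  qed
  show ?thesis
  proof (intro exI [of _ "\<delta> / n"] conjI ballI impI allI)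
    show "0 < \<delta> / n" using \<delta> n by simp
    fix \<alpha> \<mu>
    assume \<alpha>: "\<alpha> \<in> carrier_vec n" and "vdist n \<alpha> \<mu>n < \<delta> / n"
      and H: "\<mu> n = \<mu>n \<and> hypothesis_A n ?F \<alpha> \<mu>"
    then have d: "d1 n \<alpha> \<mu>n < \<delta>"
      using d1_le_vdist [of n \<alpha> \<mu>n] n by (simp add: pos_less_divide_eq mult.commute)
    \<comment> \<open>The empty vector serves as the limit of a step 0: padding it gives \<open>\<alpha>\<close>, so the starting point of step 1 is treated like all others.\<close>
    define \<nu> where "\<nu> i = (if i = 0 then 0\<^sub>v 0 else \<mu> i)" for i
    have \<nu>: "\<nu> i \<in> carrier_vec i" "\<And>r. r < i \<Longrightarrow> frozen \<alpha> ?F r (\<nu> i) = 0" if "i \<le> n" for i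
    proof -
      have 1: "\<mu> i \<in> carrier_vec i" "sys (frozen \<alpha> ?F) i (\<mu> i) = 0\<^sub>v i" if "i \<noteq> 0"
        using H that \<open>i \<le> n\<close> by (auto simp: hypothesis_A_def Let_def)
      then show "\<nu> i \<in> carrier_vec i" by (simp add: \<nu>_def)
      show "frozen \<alpha> ?F r (\<nu> i) = 0" if "r < i" for r
      proof -
        have "i \<noteq> 0" using that by simp
        from 1(2) [OF this] have "sys (frozen \<alpha> ?F) i (\<mu> i) $ r = 0" using that by simp
        then show ?thesis using that by (simp add: \<nu>_def sys_def)
      qed
    qed
    have \<nu>_near: "d1 n (pad \<alpha> (\<nu> i)) \<mu>n < \<epsilon> / 2" if "i \<le> n" for i
      using near [OF \<alpha> d that \<nu> [OF that]] by simp
    have conv: "ebe_step_converges (frozen \<alpha> ?F) (Suc k) (snoc_vec (\<nu> k) (\<alpha> $ k)) (\<mu> (Suc k))"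
      if k: "k < n" for k
    proof -
      let ?s = "snoc_vec (\<nu> k) (\<alpha> $ k)"
      have s: "?s \<in> carrier_vec (Suc k)" using \<nu>(1) [of k] k by simp
      have m: "\<nu> (Suc k) \<in> carrier_vec (Suc k)" using \<nu>(1) [of "Suc k"] k by simp
      have "d1 (Suc k) ?s (\<nu> (Suc k)) = d1 n (pad \<alpha> (\<nu> k)) (pad \<alpha> (\<nu> (Suc k)))"
        using d1_pad [OF \<alpha> _ s m] pad_snoc [OF \<alpha> k \<nu>(1)] k by simp
      also have "\<dots> \<le> d1 n (pad \<alpha> (\<nu> k)) \<mu>n + d1 n (pad \<alpha> (\<nu> (Suc k))) \<mu>n"
        using l1_triangle [of n "\<lambda>j. pad \<alpha> (\<nu> k) $ j" "\<lambda>j. pad \<alpha> (\<nu> (Suc k)) $ j" "\<lambda>j. \<mu>n $ j"]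
          l1_commute [of n "\<lambda>j. pad \<alpha> (\<nu> (Suc k)) $ j" "\<lambda>j. \<mu>n $ j"] by simp
      also have "\<dots> < \<epsilon>" using \<nu>_near [of k] \<nu>_near [of "Suc k"] k by simp
      finally have "d1 (Suc k) ?s (\<nu> (Suc k)) < \<rho> k" using \<epsilon>(2) [OF k] by simp
      moreover have "d1 n (pad \<alpha> (\<nu> (Suc k))) \<mu>n < \<rho> k"
        using \<nu>_near [of "Suc k"] \<epsilon>(2) [OF k] \<epsilon>(1) k by linarith
      moreover have "\<forall>r\<le>k. frozen \<alpha> ?F r (\<nu> (Suc k)) = 0"
        using \<nu>(2) [of "Suc k"] k by auto
      ultimately show ?thesis using step [OF k \<alpha> m s] by (simp add: \<nu>_def)
    qed
    have lim: "k < n \<Longrightarrow> ebe_limit ?F \<alpha> (Suc k) (\<mu> (Suc k))" for k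
    proof (induction k)
      case 0
      have "snoc_vec (\<nu> 0) (\<alpha> $ 0) = Matrix.vec 1 (\<lambda>_. \<alpha> $ 0)"
        by (intro eq_vecI) (auto simp: snoc_vec_def \<nu>_def)
      then show ?case using ebe_limit.first [of \<alpha> ?F "\<mu> 1"] conv [OF 0] by simp
    next
      case (Suc k)
      then show ?case
        using ebe_limit.step [of ?F \<alpha> "Suc k" "\<mu> (Suc k)" "\<mu> (Suc (Suc k))"] conv [of "Suc k"] \<alpha>
        by (simp add: \<nu>_def)
    qed
    show "ebe_limit ?F \<alpha> i (\<mu> i)" if "i \<in> {1..n}" for i
    proof -
      have "i - 1 < n" "Suc (i - 1) = i" using that by auto
      then show ?thesis using lim [of "i - 1"] by metis
    qed
    show "ebe_limit ?F \<alpha> n \<mu>n"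
      using lim [of "n - 1"] n H by simp
  qed
qed

end
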